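(* Assume the following. (1) The weight $w$ is bounded and Lipschitz. (2) $K_Z:\mathbb R^d\to[0,\infty)$ and $K_U:\mathbb R^2\to[0,\infty)$ are bounded, Lipschitz, integrate to one, are supported in the closed unit balls of $\mathbb R^d$ and $\mathbb R^2$ respectively, and there are $\rho_{K,Z},\rho_{K,U},k_Z,k_U>0$ with $K_Z(x)\ge k_Z$ whenever $\|x\|\le\rho_{K,Z}$ and $K_U(y)\ge k_U$ whenever $\|y\|\le\rho_{K,U}$. The positive bandwidths $h_Z=h_{Z,n}$, $h_U=h_{U,n}$ satisfy $h_Z\to0$, $h_U\to0$ and $nh_Z^dh_U^2/\log n\to\infty$. (3) $\mathcal Z\subset\mathbb R^d$ is compact and there are $\rho_Z,\eta_Z>0$ such that for every $z\in\mathcal Z$ there is a unit vector $\xi_z$ with $\{z+tv:0<t<\rho_Z,\ \|v\|=1,\ \|v-\xi_z\|<\eta_Z\}\subset\mathcal Z$. (4) $\Lambda_z^w$ is absolutely continuous with respect to Lebesgue measure on $\overline\Omega_L$, with density $\lambda_w:\mathcal Z\times\overline\Omega_L\to[0,\infty)$ that is bounded and uniformly continuous. (5) There is $M_w<\infty$ with $\mu_i^w(\overline\Omega_L)\le M_w$ almost surely. (6) The law $P_Z$ of $Z$ has a density $p_Z\le C_Z<\infty$ on $\mathcal Z$. Let $\rho_n\downarrow0$. For every $\varepsilon>0$, suppose there exist a measurable $A_\varepsilon\subset\mathcal Z$, $m_{\varepsilon,n}>0$ and $\delta_{\varepsilon,n}\downarrow0$ (with $\delta_{\varepsilon,n}\in(0,1)$)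 such that $$P_Z(A_\varepsilon)>1-\varepsilon,\qquad\inf_{z\in A_\varepsilon}D_h(z)\ge m_{\varepsilon,n},\qquad\frac{r_n(h_Z,h_U,\delta_{\varepsilon,n})}{m_{\varepsilon,n}}\to0,\qquad\rho_n\le\frac{m_{\varepsilon,n}}2\ \text{ eventually}.$$ If $\|\lambda_w\|_\infty<B<\infty$, then $$\mathcal L_{\mathrm{IU}}(\widehat\lambda^{\rho_n,B}_{w,n},\lambda_w)\to0\quad\text{in probability}.$$
   Context: Fix $L>0$ and let $\Omega_L=\{(b,t):0\le b<t\le L\}$, $\overline\Omega_L=\{(b,t):0\le b\le t\le L\}$, $\Delta_L=\{(b,b):0\le b\le L\}$. $\|\cdot\|$ is the Euclidean norm and $\|g\|_\infty=\sup_{z\in\mathcal Z,u\in\overline\Omega_L}|g(z,u)|$. A persistence diagram $D$ supported in $\Omega_L$ is identified with a locally finite counting measure $\mu_D=\sum_{x\in D}a_x\delta_x$, $a_x\in\mathbb N$. A weight is a measurable $w:\overline\Omega_L\to[0,\infty)$ with $w=0$ on $\Delta_L$; $\mu_D^w(A)=\int_Aw\,d\mu_D$ for Borel $A\subseteq\overline\Omega_L$. $(Z_i,D_i)$, $i=1,\dots,n$, are i.i.d. copies of $(Z,D)$, with $Z\in\mathcal Z\subset\mathbb R^d$ and $D$ a random persistence diagram. Put $\mu_i^w=\mu_{D_i}^w$ and $\Lambda_z^w(A)=\mathbb E[\mu_i^w(A)\mid Z_i=z]$. For $h>0$ define $c_{Z,h}(z)=\int_{\mathcal Z}h^{-d}K_Z((z'-z)/h)\,dz'$,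 $c_{U,h}(u)=\int_{\overline\Omega_L}h^{-2}K_U((v-u)/h)\,dv$, $\kappa_{Z,h}(z,z')=h^{-d}K_Z((z'-z)/h)/c_{Z,h}(z)$, $\kappa_{U,h}(u,v)=h^{-2}K_U((v-u)/h)/c_{U,h}(u)$, and $Y^w_{i,h_U}(u)=\int_{\overline\Omega_L}\kappa_{U,h_U}(u,v)\,d\mu_i^w(v)$. Set $\widehat D_n(z)=\frac1n\sum_i\kappa_{Z,h_Z}(z,Z_i)$, $D_h(z)=\mathbb E\widehat D_n(z)$, $\widehat N_n(z,u)=\frac1n\sum_i\kappa_{Z,h_Z}(z,Z_i)Y^w_{i,h_U}(u)$, and, with $\vee,\wedge$ denoting max and min, $$\widehat\lambda^{\rho_n,B}_{w,n}(z,u)=\left\{\frac{\widehat N_n(z,u)}{\widehat D_n(z)\vee\rho_n}\right\}\wedge B.$$ The rate function is $$r_n(h_Z,h_U,\delta)=\sqrt{\frac{\log(Cn/(\delta h_Z^dh_U^2))}{nh_Z^dh_U^2}}+\frac{\log(Cn/(\delta h_Z^dh_U^2))}{nh_Z^dh_U^2}$$ with $C\ge1$ a fixed constant. The integrated uniform loss is $\mathcal L_{\mathrm{IU}}(\widehat\lambda,\lambda_w)=\int_{\mathcal Z}\sup_{u\in\overline\Omega_L}|\widehat\lambda(z,u)-\lambda_w(z,u)|\,dP_Z(z)$. *)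

theory Defs
  imports "HOL-Probability.Probability"
begin

definition Omega :: "real \<Rightarrow> (real \<times> real) set" where
  "Omega L = {(b, t). 0 \<le> b \<and> b < t \<and> t \<le> L}"

definition Omega_closed :: "real \<Rightarrow> (real \<times> real) set" where
  "Omega_closed L = {(b, t). 0 \<le> b \<and> b \<le> t \<and> t \<le> L}"

definition Diagonal :: "real \<Rightarrow> (real \<times> real) set" where
  "Diagonal L = {(b, b) | b. 0 \<le> b \<and> b \<le> L}"


subsection \<open>Persistence diagrams and their measures\<close>

text \<open>A diagram is its multiplicity function \<open>x \<mapsto> a\<^sub>x\<close>. Local finiteness is taken in
  \<open>Omega L\<close>, so infinitely many points may accumulate at the diagonal.\<close>

type_synonym diagram = "real \<times> real \<Rightarrow> nat"

definition diagrams :: "real \<Rightarrow> diagram set" where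
  "diagrams L = {a. (\<forall>x. a x \<noteq> 0 \<longrightarrow> x \<in> Omega L) \<and>
                    (\<forall>C. compact C \<longrightarrow> C \<subseteq> Omega L \<longrightarrow> finite {x \<in> C. a x \<noteq> 0})}"

text \<open>The measure \<open>\<Sum>\<^sub>x a\<^sub>x \<delta>\<^sub>x\<close> on the Borel sets of \<open>Omega_closed L\<close>.\<close>

definition diagram_measure :: "real \<Rightarrow> diagram \<Rightarrow> (real \<times> real) measure" where
  "diagram_measure L a =
     distr (point_measure (Omega L) (\<lambda>x. of_nat (a x))) (restrict_space borel (Omega_closed L)) (\<lambda>x. x)"

definition weighted_diagram_measure ::
    "real \<Rightarrow> (real \<times> real \<Rightarrow> real) \<Rightarrow> diagram \<Rightarrow> (real \<times> real) measure" where
  "weighted_diagram_measure L w a = density (diagram_measure L a) (\<lambda>u. ennreal (w u))"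

text \<open>The usual \<open>\<sigma>\<close>-algebra of point processes: the coarsest one for which the number of
  points in each Borel set is measurable.\<close>

definition diagram_space :: "real \<Rightarrow> diagram measure" where
  "diagram_space L = sigma (diagrams L)
     {(\<lambda>a. emeasure (diagram_measure L a) A) -` S \<inter> diagrams L | A S.
        A \<in> sets (restrict_space borel (Omega_closed L)) \<and> S \<in> sets borel}"

definition weight :: "real \<Rightarrow> (real \<times> real \<Rightarrow> real) \<Rightarrow> bool" where
  "weight L w \<longleftrightarrow> w \<in> borel_measurable (restrict_space borel (Omega_closed L)) \<and>
     (\<forall>u \<in> Omega_closed L. 0 \<le> w u) \<and> (\<forall>u \<in> Diagonal L. w u = 0)"

text \<open>\<open>\<Lambda> z A\<close> is a version, for every Borel set \<open>A\<close>, of the conditional expectation of the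
  weighted mass of \<open>A\<close> given \<open>Z = z\<close>; the conditioning \<open>\<sigma>\<close>-algebra is the one generated by \<open>Z\<close>.\<close>

definition conditional_intensity ::
    "'a measure \<Rightarrow> 'z::topological_space set \<Rightarrow> real \<Rightarrow> (real \<times> real \<Rightarrow> real) \<Rightarrow>
     ('a \<Rightarrow> 'z) \<Rightarrow> ('a \<Rightarrow> diagram) \<Rightarrow> ('z \<Rightarrow> (real \<times> real) measure) \<Rightarrow> bool" where
  "conditional_intensity M ZZ L w Z D \<Lambda> \<longleftrightarrow>
     (\<forall>z \<in> ZZ. sets (\<Lambda> z) = sets (restrict_space borel (Omega_closed L))) \<and>
     (\<forall>A \<in> sets (restrict_space borel (Omega_closed L)).
        (\<lambda>z. emeasure (\<Lambda> z) A) \<in> borel_measurable (restrict_space borel ZZ) \<and>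
        (AE \<omega> in M.
           nn_cond_exp M (vimage_algebra (space M) Z (restrict_space borel ZZ))
             (\<lambda>\<omega>. emeasure (weighted_diagram_measure L w (D \<omega>)) A) \<omega>
           = emeasure (\<Lambda> (Z \<omega>)) A))"


subsection \<open>Kernels, estimator and loss\<close>

definition smoothing_kernel :: "('a::euclidean_space \<Rightarrow> real) \<Rightarrow> bool" where
  "smoothing_kernel K \<longleftrightarrow>
     (\<forall>x. 0 \<le> K x) \<and> bounded (range K) \<and> (\<exists>C. C-lipschitz_on UNIV K) \<and>
     integrable lborel K \<and> (\<integral>x. K x \<partial>lborel) = 1 \<and>
     (\<forall>x. x \<notin> cball 0 1 \<longrightarrow> K x = 0) \<and>
     (\<exists>r>0. \<exists>k>0. \<forall>x. norm x \<le> r \<longrightarrow> k \<le> K x)"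

text \<open>The two normalising constants and the two normalised kernels of the estimator are the
  instances \<open>S \<subseteq> real ^ 'd\<close> and \<open>S = Omega_closed L\<close>, where \<open>DIM\<close> is \<open>CARD('d)\<close> and \<open>2\<close>.\<close>

definition scaled_kernel :: "('a::euclidean_space \<Rightarrow> real) \<Rightarrow> real \<Rightarrow> 'a \<Rightarrow> 'a \<Rightarrow> real" where
  "scaled_kernel K h x y = K ((y - x) /\<^sub>R h) / h ^ DIM('a)"

definition kernel_mass :: "'a::euclidean_space set \<Rightarrow> ('a \<Rightarrow> real) \<Rightarrow> real \<Rightarrow> 'a \<Rightarrow> real" where
  "kernel_mass S K h x = (LINT y:S|lborel. scaled_kernel K h x y)"

definition normalized_kernel ::
    "'a::euclidean_space set \<Rightarrow> ('a \<Rightarrow> real) \<Rightarrow> real \<Rightarrow> 'a \<Rightarrow> 'a \<Rightarrow> real" where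
  "normalized_kernel S K h x y = scaled_kernel K h x y / kernel_mass S K h x"

definition smoothed_diagram ::
    "real \<Rightarrow> (real \<times> real \<Rightarrow> real) \<Rightarrow> (real \<times> real \<Rightarrow> real) \<Rightarrow> real \<Rightarrow> diagram \<Rightarrow> real \<times> real \<Rightarrow> real" where
  "smoothed_diagram L w KU hU a u =
     (\<integral>v. normalized_kernel (Omega_closed L) KU hU u v \<partial>weighted_diagram_measure L w a)"

text \<open>In the following, \<open>zs\<close> and \<open>as\<close> are the observed covariates and diagrams; the sample of
  size \<open>n\<close> consists of the indices \<open>i < n\<close>.\<close>

definition D_hat ::
    "'z::euclidean_space set \<Rightarrow> ('z \<Rightarrow> real) \<Rightarrow> real \<Rightarrow> nat \<Rightarrow> (nat \<Rightarrow> 'z) \<Rightarrow> 'z \<Rightarrow> real" where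
  "D_hat ZZ KZ hZ n zs z = (1 / real n) * (\<Sum>i<n. normalized_kernel ZZ KZ hZ z (zs i))"

definition N_hat ::
    "'z::euclidean_space set \<Rightarrow> real \<Rightarrow> (real \<times> real \<Rightarrow> real) \<Rightarrow> ('z \<Rightarrow> real) \<Rightarrow> (real \<times> real \<Rightarrow> real) \<Rightarrow>
     real \<Rightarrow> real \<Rightarrow> nat \<Rightarrow> (nat \<Rightarrow> 'z) \<Rightarrow> (nat \<Rightarrow> diagram) \<Rightarrow> 'z \<Rightarrow> real \<times> real \<Rightarrow> real" where
  "N_hat ZZ L w KZ KU hZ hU n zs as z u =
     (1 / real n) * (\<Sum>i<n. normalized_kernel ZZ KZ hZ z (zs i) * smoothed_diagram L w KU hU (as i) u)"

definition lambda_hat ::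
    "'z::euclidean_space set \<Rightarrow> real \<Rightarrow> (real \<times> real \<Rightarrow> real) \<Rightarrow> ('z \<Rightarrow> real) \<Rightarrow> (real \<times> real \<Rightarrow> real) \<Rightarrow>
     real \<Rightarrow> real \<Rightarrow> real \<Rightarrow> real \<Rightarrow> nat \<Rightarrow> (nat \<Rightarrow> 'z) \<Rightarrow> (nat \<Rightarrow> diagram) \<Rightarrow> 'z \<Rightarrow> real \<times> real \<Rightarrow> real" where
  "lambda_hat ZZ L w KZ KU hZ hU \<rho> B n zs as z u =
     min (N_hat ZZ L w KZ KU hZ hU n zs as z u / max (D_hat ZZ KZ hZ n zs z) \<rho>) B"

definition rate :: "nat \<Rightarrow> real \<Rightarrow> nat \<Rightarrow> real \<Rightarrow> real \<Rightarrow> real \<Rightarrow> real" where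
  "rate d C n hZ hU \<delta> =
     sqrt (ln (C * real n / (\<delta> * hZ ^ d * hU\<^sup>2)) / (real n * hZ ^ d * hU\<^sup>2)) +
     ln (C * real n / (\<delta> * hZ ^ d * hU\<^sup>2)) / (real n * hZ ^ d * hU\<^sup>2)"

definition integrated_uniform_loss ::
    "'z measure \<Rightarrow> real \<Rightarrow> ('z \<Rightarrow> real \<times> real \<Rightarrow> real) \<Rightarrow> ('z \<Rightarrow> real \<times> real \<Rightarrow> real) \<Rightarrow> ennreal" where
  "integrated_uniform_loss PZ L f g =
     (\<integral>\<^sup>+z. (SUP u \<in> Omega_closed L. ennreal \<bar>f z u - g z u\<bar>) \<partial>PZ)"

text \<open>Outer measure agrees with the probability of the event whenever the event is measurable.
  With \<open>measure M\<close> instead, a non-measurable event would silently count as null.\<close>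

definition tendsto_zero_in_probability :: "'a measure \<Rightarrow> (nat \<Rightarrow> 'a \<Rightarrow> ennreal) \<Rightarrow> bool" where
  "tendsto_zero_in_probability M X \<longleftrightarrow>
     (\<forall>e::real. 0 < e \<longrightarrow>
        (\<lambda>n. outer_measure_of M {\<omega> \<in> space M. ennreal e < X n \<omega>}) \<longlonglongrightarrow> 0)"

end

theory Submission
  imports Defs
begin

text \<open>
  The loss integrates over the covariate \<open>z\<close>, so only the supremum over \<open>u\<close> has to be controlled
  uniformly; by Tonelli and Markov it suffices to bound, for each single \<open>z\<close> in the good region \<open>A\<close>,
  the probability that the estimator at \<open>z\<close> is far from \<open>\<lambda>\<^sub>w(z, _)\<close> somewhere
  (\<open>outer_measure_loss_le\<close>). Off \<open>A\<close>, and on the exceptional event, the truncation at \<open>B\<close> makes the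
  error at most \<open>B\<close>.

  Fix \<open>z\<close> and let \<open>d = D\<^sub>h(z) \<ge> m\<close>. Numerator and denominator are averages of independent
  nonnegative terms bounded by \<open>b = O(1/(h\<^sub>Z\<^sup>d h\<^sub>U\<^sup>2))\<close> whose means are at most a constant times \<open>d\<close>.
  For such averages a multiplicative Chernoff bound controls deviations \<^emph>\<open>relative\<close> to \<open>d\<close>: they exceed
  \<open>t d\<close> with probability at most \<open>2 exp(- c n d / b)\<close> (\<open>relative_deviation_bound\<close>). Relative control is
  what a ratio needs, since \<open>m\<close> may tend to zero. The bias is relative as well: conditioning on
  the covariate turns the mean of the numerator into an average of \<open>\<lambda>\<^sub>w\<close> over a small neighbourhood
  of \<open>(z, u)\<close>, times \<open>d\<close> (\<open>mean_N_le\<close>, \<open>mean_N_ge\<close>), so uniform continuity of \<open>\<lambda>\<^sub>w\<close> suffices.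

  Passing from one \<open>u\<close> to all \<open>u\<close> takes a finite net of the triangle. The smoothed diagrams are
  Lipschitz in \<open>u\<close> with a constant polynomial in \<open>1/h\<^sub>U\<close>, because the masses by which the kernels are
  normalised stay away from zero: every point of either domain sees balls of radius comparable to the
  bandwidth inside the domain (\<open>uniform_interior_balls\<close>). The net has polynomially many points in
  \<open>1/h\<^sub>U\<close>, hence in \<open>n\<close>, while the rate condition says that \<open>n h\<^sub>Z\<^sup>d h\<^sub>U\<^sup>2 m\<close> grows faster than
  \<open>ln n\<close>, so the exponential beats the union bound (\<open>tail_times_net_tendsto_0\<close>).
\<close>

section \<open>Relative deviations of averages of bounded nonnegative variables\<close>

lemma exp_le_quadratic:
  fixes x :: real
  assumes "\<bar>x\<bar> \<le> 1"
  shows "exp x - 1 - x \<le> x\<^sup>2"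
proof (cases "0 \<le> x")
  case True
  then show ?thesis using exp_bound[of x] assms by auto
next
  case False
  define y where "y = - x"
  have y: "0 < y" using False by (simp add: y_def)
  have "exp x = 1 / exp y" by (simp add: y_def exp_minus field_simps)
  also have "\<dots> \<le> 1 / (1 + y)"
    using y by (intro divide_left_mono) auto
  also have "\<dots> \<le> 1 - y + y\<^sup>2"
  proof -
    have "0 \<le> y ^ 3" using y by simp
    then have "1 \<le> (1 - y + y\<^sup>2) * (1 + y)"
      by (simp add: algebra_simps power2_eq_square power3_eq_cube)
    then show ?thesis using y by (simp add: pos_divide_le_eq)
  qed
  finally show ?thesis by (simp add: y_def)
qed

lemma exp_le_chord:
  fixes x \<theta> :: real
  assumes "0 \<le> x" "x \<le> 1"
  shows "exp (\<theta> * x) \<le> 1 + x * (exp \<theta> - 1)"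
proof -
  have "exp ((1 - x) *\<^sub>R 0 + x *\<^sub>R \<theta>) \<le> (1 - x) * exp 0 + x * exp \<theta>"
    using assms by (intro convex_onD[OF exp_convex]) auto
  then show ?thesis by (simp add: algebra_simps)
qed

context prob_space
begin

text \<open>Bounding \<open>exp\<close> by its chord on \<open>[0, b]\<close> brings in only the mean of \<open>X\<close>. The variance is thereby
  replaced by \<open>b\<close> times the mean, which is where the relative form of the deviation bound comes from.\<close>

lemma expectation_exp_bounded_le:
  fixes X :: "'a \<Rightarrow> real"
  assumes X[measurable]: "X \<in> borel_measurable M" and b: "0 < b"
    and bnd: "AE \<omega> in M. 0 \<le> X \<omega> \<and> X \<omega> \<le> b"
  shows "integrable M (\<lambda>\<omega>. exp (\<theta> * X \<omega> / b))"
    and "expectation (\<lambda>\<omega>. exp (\<theta> * X \<omega> / b)) \<le> exp (expectation X * (exp \<theta> - 1) / b)"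
proof -
  have pt: "AE \<omega> in M. exp (\<theta> * X \<omega> / b) \<le> 1 + X \<omega> * (exp \<theta> - 1) / b"
    using bnd
  proof eventually_elim
    case (elim \<omega>)
    then have "exp (\<theta> * (X \<omega> / b)) \<le> 1 + X \<omega> / b * (exp \<theta> - 1)"
      using b by (intro exp_le_chord) auto
    then show ?case by simp
  qed
  have iX: "integrable M X"
    using bnd by (intro integrable_const_bound[where B=b]) auto
  have "AE \<omega> in M. norm (exp (\<theta> * X \<omega> / b)) \<le> 1 + b * \<bar>exp \<theta> - 1\<bar> / b"
    using pt bnd
  proof eventually_elim
    case (elim \<omega>)
    have "X \<omega> * (exp \<theta> - 1) \<le> b * \<bar>exp \<theta> - 1\<bar>"
      using elim mult_left_mono[of "exp \<theta> - 1" "\<bar>exp \<theta> - 1\<bar>" "X \<omega>"]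
        mult_right_mono[of "X \<omega>" b "\<bar>exp \<theta> - 1\<bar>"] by linarith
    then have "X \<omega> * (exp \<theta> - 1) / b \<le> b * \<bar>exp \<theta> - 1\<bar> / b"
      using b by (intro divide_right_mono) auto
    then show ?case using elim by simp
  qed
  then show i: "integrable M (\<lambda>\<omega>. exp (\<theta> * X \<omega> / b))"
    by (intro integrable_const_bound) auto
  have "expectation (\<lambda>\<omega>. exp (\<theta> * X \<omega> / b)) \<le> expectation (\<lambda>\<omega>. 1 + X \<omega> * (exp \<theta> - 1) / b)"
    using pt iX i by (intro integral_mono_AE) auto
  also have "\<dots> = 1 + expectation X * (exp \<theta> - 1) / b"
    using iX by (simp add: prob_space)
  also have "\<dots> \<le> exp (expectation X * (exp \<theta> - 1) / b)"
    by simp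
  finally show "expectation (\<lambda>\<omega>. exp (\<theta> * X \<omega> / b)) \<le> exp (expectation X * (exp \<theta> - 1) / b)" .
qed

text \<open>The Chernoff bound for both tails at once: the sign \<open>\<sigma>\<close> selects the tail, and \<open>\<sigma> * \<eta>\<close> is the
  exponential tilt measured in units of \<open>1 / b\<close>.\<close>

lemma relative_tail_one_sided:
  fixes X :: "nat \<Rightarrow> 'a \<Rightarrow> real"
  assumes indep: "indep_vars (\<lambda>_. borel) X {..<n}" and b: "0 < b"
    and bnd: "\<And>i. i < n \<Longrightarrow> AE \<omega> in M. 0 \<le> X i \<omega> \<and> X i \<omega> \<le> b"
    and mean: "\<And>i. i < n \<Longrightarrow> expectation (X i) = \<mu>"
    and \<mu>0: "0 \<le> \<mu>" and \<sigma>: "\<bar>\<sigma>\<bar> = 1" and \<eta>: "0 < \<eta>" "\<eta> \<le> 1"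
  shows "prob {\<omega> \<in> space M. real n * \<tau> \<le> \<sigma> * ((\<Sum>i<n. X i \<omega>) - real n * \<mu>)}
           \<le> exp (real n / b * (\<mu> * \<eta>\<^sup>2 - \<eta> * \<tau>))"
proof -
  define \<theta> where "\<theta> = \<sigma> * \<eta>"
  have meas: "\<And>i. i < n \<Longrightarrow> X i \<in> borel_measurable M"
    using indep unfolding indep_vars_def by auto
  define P where "P \<omega> = (\<Prod>i<n. exp (\<theta> * X i \<omega> / b))" for \<omega>
  have indepE: "indep_vars (\<lambda>_. borel) (\<lambda>i \<omega>. exp (\<theta> * X i \<omega> / b)) {..<n}"
    by (rule indep_vars_compose2[OF indep]) auto
  have intE: "\<And>i. i < n \<Longrightarrow> integrable M (\<lambda>\<omega>. exp (\<theta> * X i \<omega> / b))"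
    by (rule expectation_exp_bounded_le(1)) (use meas bnd b in auto)
  have EP: "expectation P = (\<Prod>i<n. expectation (\<lambda>\<omega>. exp (\<theta> * X i \<omega> / b)))"
    unfolding P_def by (rule indep_vars_lebesgue_integral) (use indepE intE in auto)
  have iP: "integrable M P"
    unfolding P_def by (rule indep_vars_integrable) (use indepE intE in auto)
  have Psum: "P \<omega> = exp (\<theta> / b * (\<Sum>i<n. X i \<omega>))" for \<omega>
    by (simp add: P_def exp_sum[symmetric] sum_distrib_left)
  define c where "c = exp (1 / b * (real n * (\<theta> * \<mu> + \<eta> * \<tau>)))"
  have "{\<omega> \<in> space M. real n * \<tau> \<le> \<sigma> * ((\<Sum>i<n. X i \<omega>) - real n * \<mu>)}
     = {\<omega> \<in> space M. c \<le> P \<omega>}"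
  proof -
    have "real n * \<tau> \<le> \<sigma> * ((\<Sum>i<n. X i \<omega>) - real n * \<mu>) \<longleftrightarrow> c \<le> P \<omega>" for \<omega>
    proof -
      have "c \<le> P \<omega> \<longleftrightarrow> real n * (\<theta> * \<mu> + \<eta> * \<tau>) \<le> \<theta> * (\<Sum>i<n. X i \<omega>)"
        using b by (simp add: c_def Psum divide_le_cancel)
      also have "\<dots> \<longleftrightarrow> \<eta> * (real n * \<tau>) \<le> \<eta> * (\<sigma> * ((\<Sum>i<n. X i \<omega>) - real n * \<mu>))"
        by (simp add: \<theta>_def algebra_simps)
      also have "\<dots> \<longleftrightarrow> real n * \<tau> \<le> \<sigma> * ((\<Sum>i<n. X i \<omega>) - real n * \<mu>)"
        using \<eta> by simp
      finally show ?thesis by simp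
    qed
    then show ?thesis by simp
  qed
  then have "prob {\<omega> \<in> space M. real n * \<tau> \<le> \<sigma> * ((\<Sum>i<n. X i \<omega>) - real n * \<mu>)}
     \<le> expectation P / c"
    using integral_Markov_inequality_measure[OF iP, of "{}" c] by (simp add: c_def P_def[abs_def] prod_nonneg)
  also have "\<dots> \<le> exp (real n * (\<mu> * (exp \<theta> - 1) / b)) / c"
  proof (intro divide_right_mono)
    have "expectation P \<le> (\<Prod>i<n. exp (\<mu> * (exp \<theta> - 1) / b))"
      unfolding EP
    proof (intro prod_mono conjI)
      fix i assume "i \<in> {..<n}"
      then show "expectation (\<lambda>\<omega>. exp (\<theta> * X i \<omega> / b)) \<le> exp (\<mu> * (exp \<theta> - 1) / b)"
        using expectation_exp_bounded_le(2)[of "X i" b \<theta>] meas bnd b mean by auto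
    qed auto
    also have "\<dots> = exp (real n * (\<mu> * (exp \<theta> - 1) / b))"
      by (simp add: exp_of_nat_mult[symmetric])
    finally show "expectation P \<le> exp (real n * (\<mu> * (exp \<theta> - 1) / b))" .
  qed (simp add: c_def)
  also have "\<dots> = exp (real n / b * (\<mu> * (exp \<theta> - 1 - \<theta>) - \<eta> * \<tau>))"
    unfolding c_def exp_diff[symmetric]
    by (rule arg_cong[where f=exp]) (simp add: diff_divide_distrib add_divide_distrib algebra_simps)
  also have "\<dots> \<le> exp (real n / b * (\<mu> * \<eta>\<^sup>2 - \<eta> * \<tau>))"
  proof -
    have sq: "\<theta>\<^sup>2 = \<eta>\<^sup>2" using \<sigma> by (simp add: \<theta>_def power_mult_distrib abs_square_eq_1)
    have "\<bar>\<theta>\<bar> \<le> 1" using \<sigma> \<eta> by (simp add: \<theta>_def abs_mult)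
    then have "exp \<theta> - 1 - \<theta> \<le> \<eta>\<^sup>2" unfolding sq[symmetric] by (rule exp_le_quadratic)
    then have "\<mu> * (exp \<theta> - 1 - \<theta>) \<le> \<mu> * \<eta>\<^sup>2" using \<mu>0 by (rule mult_left_mono)
    then have "real n / b * (\<mu> * (exp \<theta> - 1 - \<theta>) - \<eta> * \<tau>) \<le> real n / b * (\<mu> * \<eta>\<^sup>2 - \<eta> * \<tau>)"
      using b by (intro mult_left_mono[of "\<mu> * (exp \<theta> - 1 - \<theta>) - \<eta> * \<tau>"]) auto
    then show ?thesis by (simp only: exp_le_cancel_iff)
  qed
  finally show ?thesis .
qed

text \<open>The scale \<open>d\<close> dominates the mean up to the factor \<open>\<kappa>\<close>. This allows one common scale for the
  numerator and the denominator of the estimator, whose means differ.\<close>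

lemma relative_deviation_bound:
  fixes X :: "nat \<Rightarrow> 'a \<Rightarrow> real"
  assumes indep: "indep_vars (\<lambda>_. borel) X {..<n}" and b: "0 < b" and n: "0 < n"
    and bnd: "\<And>i. i < n \<Longrightarrow> AE \<omega> in M. 0 \<le> X i \<omega> \<and> X i \<omega> \<le> b"
    and mean: "\<And>i. i < n \<Longrightarrow> expectation (X i) = \<mu>"
    and \<mu>: "\<mu> \<le> \<kappa> * d" and d: "0 < d" and t: "0 < t" "t \<le> 2 * \<kappa>"
  shows "prob {\<omega> \<in> space M. t * d < \<bar>1 / real n * (\<Sum>i<n. X i \<omega>) - \<mu>\<bar>}
           \<le> 2 * exp (- (t\<^sup>2 / (4 * \<kappa>)) * (real n * d / b))"
proof -
  have meas[measurable]: "\<And>i. i < n \<Longrightarrow> X i \<in> borel_measurable M"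
    using indep unfolding indep_vars_def by auto
  have \<kappa>: "0 < \<kappa>" using t by linarith
  have "AE \<omega> in M. 0 \<le> X 0 \<omega>" using bnd[OF n] by auto
  then have \<mu>0: "0 \<le> \<mu>" using mean[OF n] integral_nonneg_AE[of "X 0" M] by auto
  (* minimises \<kappa> * \<eta>\<^sup>2 - t * \<eta> *)
  define \<eta> where "\<eta> = t / (2 * \<kappa>)"
  have \<eta>: "0 < \<eta>" "\<eta> \<le> 1" using t \<kappa> by (auto simp: \<eta>_def)
  let ?S = "\<lambda>\<omega>. \<Sum>i<n. X i \<omega>"
  let ?E = "\<lambda>\<sigma>. {\<omega> \<in> space M. real n * (t * d) \<le> \<sigma> * (?S \<omega> - real n * \<mu>)}"
  have tail: "prob (?E \<sigma>) \<le> exp (- (t\<^sup>2 / (4 * \<kappa>)) * (real n * d / b))" if "\<bar>\<sigma>\<bar> = 1" for \<sigma>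
  proof -
    have "prob (?E \<sigma>) \<le> exp (real n / b * (\<mu> * \<eta>\<^sup>2 - \<eta> * (t * d)))"
      by (rule relative_tail_one_sided[OF indep b bnd mean \<mu>0 that \<eta>])
    also have "\<dots> \<le> exp (real n / b * (\<kappa> * d * \<eta>\<^sup>2 - \<eta> * (t * d)))"
      using mult_right_mono[OF \<mu>, of "\<eta>\<^sup>2"] b by (auto intro!: divide_right_mono mult_left_mono)
    also have "\<kappa> * d * \<eta>\<^sup>2 - \<eta> * (t * d) = - (t\<^sup>2 / (4 * \<kappa>)) * d"
      using \<kappa> by (simp add: \<eta>_def field_simps power2_eq_square)
    finally show ?thesis by (simp add: mult_ac)
  qed
  have [measurable]: "?S \<in> borel_measurable M" by (intro borel_measurable_sum) auto
  have "prob {\<omega> \<in> space M. t * d < \<bar>1 / real n * ?S \<omega> - \<mu>\<bar>} \<le> prob (?E 1 \<union> ?E (-1))"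
  proof (intro finite_measure_mono)
    show "{\<omega> \<in> space M. t * d < \<bar>1 / real n * ?S \<omega> - \<mu>\<bar>} \<subseteq> ?E 1 \<union> ?E (-1)"
    proof safe
      fix \<omega> assume *: "t * d < \<bar>1 / real n * ?S \<omega> - \<mu>\<bar>"
        "\<not> real n * (t * d) \<le> - 1 * (?S \<omega> - real n * \<mu>)"
      have eq: "?S \<omega> - real n * \<mu> = real n * (1 / real n * ?S \<omega> - \<mu>)"
        using n by (simp add: field_simps)
      have "real n * (t * d) < real n * \<bar>1 / real n * ?S \<omega> - \<mu>\<bar>"
        using *(1) n by simp
      also have "\<dots> = \<bar>?S \<omega> - real n * \<mu>\<bar>" unfolding eq by (simp add: abs_mult)
      finally show "real n * (t * d) \<le> 1 * (?S \<omega> - real n * \<mu>)" using *(2) by auto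
    qed
  qed auto
  also have "\<dots> \<le> prob (?E 1) + prob (?E (-1))"
    by (rule measure_Un_le; measurable)
  also have "\<dots> \<le> 2 * exp (- (t\<^sup>2 / (4 * \<kappa>)) * (real n * d / b))"
    using tail[of 1] tail[of "-1"] by simp
  finally show ?thesis .
qed

end

section \<open>From pointwise exceptional events to the integrated loss\<close>

text \<open>For the estimator, \<open>\<Phi>\<close> is a supremum over uncountably many points, so it is dominated by means of a
  measurable set \<open>Bad\<close> containing the pairs over \<open>A\<close> at which it is large. Its integral is at most
  \<open>\<tau> + B * (1 - P A) + B * P {z \<in> A. (z, \<omega>) \<in> Bad}\<close>, whose last term has expectation at most \<open>B * q\<close>.\<close>

lemma outer_measure_loss_le:
  fixes M :: "'a measure" and P :: "'z measure"
    and \<Phi> :: "'z \<Rightarrow> 'a \<Rightarrow> ennreal"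
  assumes "prob_space M" "prob_space P"
    and Bad[measurable]: "Bad \<in> sets (P \<Otimes>\<^sub>M M)" and A[measurable]: "A \<in> sets P"
    and PA: "measure P A > 1 - \<epsilon>"
    and nonneg: "0 \<le> B" "0 \<le> \<tau>" "0 \<le> q"
    and le_B: "\<And>z \<omega>. z \<in> space P \<Longrightarrow> \<omega> \<in> space M \<Longrightarrow> \<Phi> z \<omega> \<le> ennreal B"
    and le_\<tau>: "\<And>z \<omega>. z \<in> A \<Longrightarrow> \<omega> \<in> space M \<Longrightarrow> (z, \<omega>) \<notin> Bad \<Longrightarrow> \<Phi> z \<omega> \<le> ennreal \<tau>"
    and q: "\<And>z. z \<in> A \<Longrightarrow> measure M {\<omega> \<in> space M. (z, \<omega>) \<in> Bad} \<le> q"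
    and e: "0 < e" "\<tau> + B * \<epsilon> \<le> e / 2"
  shows "outer_measure_of M {\<omega> \<in> space M. ennreal e < (\<integral>\<^sup>+z. \<Phi> z \<omega> \<partial>P)} \<le> ennreal (2 * B * q / e)"
proof -
  interpret M: prob_space M by fact
  interpret P: prob_space P by fact
  interpret PM: pair_prob_space P M ..
  have \<epsilon>: "0 \<le> \<epsilon>" using PA P.prob_le_1[of A] by linarith
  define Bad' where "Bad' = Bad \<inter> (A \<times> space M)"
  have Bad'[measurable]: "Bad' \<in> sets (P \<Otimes>\<^sub>M M)" by (simp add: Bad'_def)
  define G where "G \<omega> = emeasure P ((\<lambda>z. (z, \<omega>)) -` Bad')" for \<omega>
  have G[measurable]: "G \<in> borel_measurable M"
    unfolding G_def by (rule PM.measurable_emeasure_Pair2) fact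
  have "(\<integral>\<^sup>+\<omega>. G \<omega> \<partial>M) = (\<integral>\<^sup>+z. emeasure M (Pair z -` Bad') \<partial>P)"
    using PM.emeasure_pair_measure_alt2[OF Bad'] M.emeasure_pair_measure_alt[OF Bad'] by (simp add: G_def)
  also have "\<dots> \<le> (\<integral>\<^sup>+z. ennreal q \<partial>P)"
  proof (intro nn_integral_mono)
    fix z assume "z \<in> space P"
    show "emeasure M (Pair z -` Bad') \<le> ennreal q"
    proof (cases "z \<in> A")
      case True
      then have "Pair z -` Bad' = {\<omega> \<in> space M. (z, \<omega>) \<in> Bad}"
        using sets.sets_into_space[OF Bad] by (auto simp: Bad'_def space_pair_measure)
      then show ?thesis using q[OF True] by (simp add: M.emeasure_eq_measure ennreal_leI)
    qed (auto simp: Bad'_def)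
  qed
  finally have EG: "(\<integral>\<^sup>+\<omega>. G \<omega> \<partial>M) \<le> ennreal q" by (simp add: P.emeasure_space_1)
  have loss: "(\<integral>\<^sup>+z. \<Phi> z \<omega> \<partial>P) \<le> ennreal (e / 2) + ennreal B * G \<omega>" if \<omega>: "\<omega> \<in> space M" for \<omega>
  proof -
    have [measurable]: "(\<lambda>z. (z, \<omega>)) -` Bad' \<in> sets P"
      using Bad' by (rule sets_Pair2)
    have "(\<integral>\<^sup>+z. \<Phi> z \<omega> \<partial>P) \<le>
        (\<integral>\<^sup>+z. ennreal \<tau> + ennreal B * indicator (space P - A) z
           + ennreal B * indicator ((\<lambda>z. (z, \<omega>)) -` Bad') z \<partial>P)"
    proof (intro nn_integral_mono)
      fix z assume z: "z \<in> space P"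
      show "\<Phi> z \<omega> \<le> ennreal \<tau> + ennreal B * indicator (space P - A) z
           + ennreal B * indicator ((\<lambda>z. (z, \<omega>)) -` Bad') z"
      proof (cases "z \<in> A \<and> (z, \<omega>) \<notin> Bad")
        case True
        then show ?thesis using le_\<tau>[OF _ \<omega>, of z] by (auto intro: order.trans add_increasing2)
      next
        case False
        then have "ennreal B \<le> ennreal B * indicator (space P - A) z
           + ennreal B * indicator ((\<lambda>z. (z, \<omega>)) -` Bad') z"
          using z \<omega> by (auto simp: Bad'_def indicator_def)
        then have "\<Phi> z \<omega> \<le> ennreal B * indicator (space P - A) z
           + ennreal B * indicator ((\<lambda>z. (z, \<omega>)) -` Bad') z"
          by (rule order.trans[OF le_B[OF z \<omega>]])
        then show ?thesis unfolding add.assoc by (rule add_increasing[rotated]) simp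
      qed
    qed
    also have "\<dots> = ennreal \<tau> + ennreal B * emeasure P (space P - A) + ennreal B * G \<omega>"
      by (simp add: nn_integral_add nn_integral_cmult P.emeasure_space_1 G_def)
    also have "emeasure P (space P - A) \<le> ennreal \<epsilon>"
      using PA P.prob_compl[OF A] by (simp add: P.emeasure_eq_measure ennreal_leI)
    also have "ennreal \<tau> + ennreal B * ennreal \<epsilon> \<le> ennreal (e / 2)"
      using e nonneg \<epsilon> by (simp add: ennreal_mult[symmetric] ennreal_plus[symmetric] del: ennreal_plus)
    finally show ?thesis by (simp add: add_right_mono mult_left_mono)
  qed
  have "{\<omega> \<in> space M. ennreal e < (\<integral>\<^sup>+z. \<Phi> z \<omega> \<partial>P)}
      \<subseteq> {\<omega> \<in> space M. 1 \<le> ennreal (2 * B / e) * G \<omega>}"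
  proof safe
    fix \<omega> assume \<omega>: "\<omega> \<in> space M" and big: "ennreal e < (\<integral>\<^sup>+z. \<Phi> z \<omega> \<partial>P)"
    obtain g where g: "G \<omega> = ennreal g" "0 \<le> g"
      unfolding G_def by (metis P.emeasure_eq_measure measure_nonneg)
    have "ennreal e < ennreal (e / 2 + B * g)"
      using big loss[OF \<omega>] nonneg g e by (simp add: ennreal_mult[symmetric] order.strict_trans2)
    then have "e / 2 < B * g" using e by (simp add: ennreal_less_iff)
    then have "1 \<le> 2 * B / e * g" using e by (simp add: field_simps)
    then show "1 \<le> ennreal (2 * B / e) * G \<omega>"
      using g nonneg e by (simp add: ennreal_mult[symmetric] del: ennreal_1 flip: ennreal_1)
  qed
  then have "outer_measure_of M {\<omega> \<in> space M. ennreal e < (\<integral>\<^sup>+z. \<Phi> z \<omega> \<partial>P)}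
      \<le> outer_measure_of M {\<omega> \<in> space M. 1 \<le> ennreal (2 * B / e) * G \<omega>}"
    by (rule outer_measure_of_mono)
  also have "\<dots> = emeasure M {\<omega> \<in> space M. 1 \<le> ennreal (2 * B / e) * G \<omega>}"
    by (intro outer_measure_of_eq) measurable
  also have "\<dots> \<le> ennreal (2 * B / e) * (\<integral>\<^sup>+\<omega>. G \<omega> * indicator (space M) \<omega> \<partial>M)"
    by (intro nn_integral_Markov_inequality) auto
  also have "(\<integral>\<^sup>+\<omega>. G \<omega> * indicator (space M) \<omega> \<partial>M) = (\<integral>\<^sup>+\<omega>. G \<omega> \<partial>M)"
    by (intro nn_integral_cong) auto
  also have "ennreal (2 * B / e) * (\<integral>\<^sup>+\<omega>. G \<omega> \<partial>M) \<le> ennreal (2 * B / e) * ennreal q"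
    by (intro mult_left_mono EG) auto
  also have "\<dots> = ennreal (2 * B * q / e)"
    using nonneg e by (simp add: ennreal_mult[symmetric])
  finally show ?thesis .
qed

section \<open>Interior balls and nets\<close>

text \<open>A quantitative regularity of a domain that both the cone condition and convexity provide. It is
  what bounds from below the mass of a kernel centred at any point of the domain, boundary included.\<close>

definition uniform_interior_balls :: "'a::euclidean_space set \<Rightarrow> bool" where
  "uniform_interior_balls S \<longleftrightarrow>
     (\<exists>c>0. \<exists>r0>0. \<forall>x\<in>S. \<forall>r. 0 < r \<longrightarrow> r < r0 \<longrightarrow> (\<exists>y. ball y (c * r) \<subseteq> S \<inter> cball x r))"

text \<open>The ball centred at distance \<open>r / 2\<close> along the axis of the cone, with radius a small multiple of
  \<open>r\<close>, lies in the cone: the directions of its points differ from the axis by less than \<open>8 * c\<close>.\<close>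

lemma uniform_interior_balls_cone:
  fixes S :: "'a::euclidean_space set"
  assumes "r0 > 0" "\<eta> > 0"
    and cone: "\<And>x. x \<in> S \<Longrightarrow> \<exists>\<xi>. norm \<xi> = 1 \<and>
        {x + t *\<^sub>R v | t v. 0 < t \<and> t < r0 \<and> norm v = 1 \<and> norm (v - \<xi>) < \<eta>} \<subseteq> S"
  shows "uniform_interior_balls S"
proof -
  define c where "c = min (1/4) (\<eta> / 8)"
  have c: "0 < c" "c \<le> 1/4" "8 * c \<le> \<eta>" using assms by (auto simp: c_def)
  have "\<exists>y. ball y (c * r) \<subseteq> S \<inter> cball x r" if x: "x \<in> S" and r: "0 < r" "r < r0" for x r
  proof -
    obtain \<xi> where \<xi>: "norm \<xi> = 1"
      and sub: "{x + t *\<^sub>R v | t v. 0 < t \<and> t < r0 \<and> norm v = 1 \<and> norm (v - \<xi>) < \<eta>} \<subseteq> S"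
      using cone[OF x] by blast
    have "p \<in> S \<inter> cball x r" if p: "p \<in> ball (x + (r/2) *\<^sub>R \<xi>) (c * r)" for p
    proof -
      define y where "y = p - x"
      define t where "t = norm y"
      have e: "norm (y - (r/2) *\<^sub>R \<xi>) < c * r"
        using p by (simp add: y_def dist_norm norm_minus_commute algebra_simps)
      have "\<bar>t - r / 2\<bar> \<le> norm (y - (r/2) *\<^sub>R \<xi>)"
        using norm_triangle_ineq3[of y "(r/2) *\<^sub>R \<xi>"] \<xi> r by (simp add: t_def)
      moreover have cr: "c * r \<le> r / 4" using c r by simp
      ultimately have t: "r / 4 < t" "t < r" "\<bar>t - r / 2\<bar> < c * r" using e r by linarith+
      have tpos: "0 < t" using t r by linarith
      have split: "y - t *\<^sub>R \<xi> = (y - (r/2) *\<^sub>R \<xi>) + (r / 2 - t) *\<^sub>R \<xi>" by (simp add: algebra_simps)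
      have "norm (y - t *\<^sub>R \<xi>) \<le> norm (y - (r/2) *\<^sub>R \<xi>) + \<bar>r / 2 - t\<bar>"
        unfolding split
        using norm_triangle_ineq[of "y - (r/2) *\<^sub>R \<xi>" "(r / 2 - t) *\<^sub>R \<xi>"] \<xi> by simp
      then have d: "norm (y - t *\<^sub>R \<xi>) < 2 * (c * r)" using e t by linarith
      have "y /\<^sub>R t - \<xi> = (y - t *\<^sub>R \<xi>) /\<^sub>R t" using tpos by (simp add: algebra_simps)
      then have "norm (y /\<^sub>R t - \<xi>) = norm (y - t *\<^sub>R \<xi>) / t"
        using tpos by (simp only: norm_scaleR) (simp add: divide_inverse mult.commute)
      also have "\<dots> < 2 * (c * r) / t" using d tpos by (simp add: divide_strict_right_mono)
      also have "\<dots> \<le> 2 * (c * r) / (r / 4)"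
        using t r c by (intro divide_left_mono) auto
      also have "\<dots> = 8 * c" using r by simp
      finally have "norm (y /\<^sub>R t - \<xi>) < \<eta>" using c by linarith
      moreover have "norm (y /\<^sub>R t) = 1" using tpos by (simp add: t_def)
      moreover have "p = x + t *\<^sub>R (y /\<^sub>R t)" using tpos by (simp add: y_def)
      moreover have "0 < t \<and> t < r0" using tpos t r by linarith
      ultimately have "p \<in> {x + t *\<^sub>R v | t v. 0 < t \<and> t < r0 \<and> norm v = 1 \<and> norm (v - \<xi>) < \<eta>}"
        by blast
      then have "p \<in> S" using sub by blast
      moreover have "p \<in> cball x r" using t by (simp add: t_def y_def dist_norm norm_minus_commute)
      ultimately show ?thesis by blast
    qed
    then show ?thesis by blast
  qed
  then show ?thesis unfolding uniform_interior_balls_def using c(1) assms(1) by blast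
qed

text \<open>Shrinking a ball inside \<open>S\<close> by a homothety centred at \<open>x\<close> stays inside a convex \<open>S\<close>; the ratio
  \<open>r / R\<close>, with \<open>R\<close> bounding the diameter, brings it within distance \<open>r\<close> of \<open>x\<close>.\<close>

lemma uniform_interior_balls_convex:
  fixes S :: "'a::euclidean_space set"
  assumes "convex S" "bounded S" "interior S \<noteq> {}"
  shows "uniform_interior_balls S"
proof -
  obtain p s where s: "0 < s" and ps: "ball p s \<subseteq> S"
    using assms(3) by (meson all_not_in_conv mem_interior)
  obtain R0 where R0: "\<And>x y. x \<in> S \<Longrightarrow> y \<in> S \<Longrightarrow> dist x y \<le> R0"
    using assms(2) by (meson bounded_two_points)
  define R where "R = max R0 1"
  have R: "1 \<le> R" "\<And>x y. x \<in> S \<Longrightarrow> y \<in> S \<Longrightarrow> dist x y \<le> R"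
    using R0 by (force simp: R_def)+
  have "\<exists>y. ball y (s / R * r) \<subseteq> S \<inter> cball x r" if x: "x \<in> S" and r: "0 < r" "r < 1" for x r
  proof -
    define \<tau> where "\<tau> = r / R"
    have \<tau>: "0 < \<tau>" "\<tau> \<le> 1" using r R(1) by (auto simp: \<tau>_def)
    have "q \<in> S \<inter> cball x r" if q: "q \<in> ball (x + \<tau> *\<^sub>R (p - x)) (\<tau> * s)" for q
    proof -
      define y where "y = x + (q - x) /\<^sub>R \<tau>"
      have qy: "q = (1 - \<tau>) *\<^sub>R x + \<tau> *\<^sub>R y" using \<tau> by (simp add: y_def algebra_simps)
      have "x + \<tau> *\<^sub>R (p - x) - q = \<tau> *\<^sub>R (p - y)" by (simp add: qy algebra_simps)
      then have "\<tau> * norm (p - y) < \<tau> * s" using q \<tau> by (simp add: dist_norm)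
      then have "y \<in> S" using ps \<tau> by (auto simp: dist_norm)
      then have "q \<in> S" using qy \<tau> x assms(1) by (simp add: convex_alt)
      moreover have "x - q = \<tau> *\<^sub>R (x - y)" by (simp add: qy algebra_simps)
      then have "dist x q = \<tau> * dist x y" using \<tau> by (simp add: dist_norm)
      then have "dist x q \<le> \<tau> * R" using R(2)[OF x \<open>y \<in> S\<close>] \<tau> by simp
      ultimately show ?thesis using R by (simp add: \<tau>_def)
    qed
    then show ?thesis by (intro exI[of _ "x + \<tau> *\<^sub>R (p - x)"]) (auto simp: \<tau>_def mult.commute)
  qed
  moreover have "0 < s / R" using s R by auto
  ultimately show ?thesis unfolding uniform_interior_balls_def by (meson zero_less_one)
qed

lemma Omega_closed_convex: "convex (Omega_closed L)"
proof -
  have "Omega_closed L = {u. 0 \<le> fst u} \<inter> {u. fst u \<le> snd u} \<inter> {u. snd u \<le> L}"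
    by (auto simp: Omega_closed_def)
  moreover have "convex {u::real\<times>real. 0 \<le> fst u}" "convex {u::real\<times>real. fst u \<le> snd u}" "convex {u::real\<times>real. snd u \<le> L}"
    by (auto simp: convex_def intro!: add_mono mult_left_mono convex_bound_le)
  ultimately show ?thesis by (auto intro!: convex_Int)
qed

lemma Omega_closed_compact: "compact (Omega_closed L)"
proof -
  have "Omega_closed L = {u. 0 \<le> fst u} \<inter> {u. fst u \<le> snd u} \<inter> {u. snd u \<le> L}"
    by (auto simp: Omega_closed_def)
  moreover have "closed {u::real\<times>real. 0 \<le> fst u}" "closed {u::real\<times>real. fst u \<le> snd u}" "closed {u::real\<times>real. snd u \<le> L}"
    by (auto intro!: closed_Collect_le continuous_intros)
  ultimately have cl: "closed (Omega_closed L)" by auto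
  have "bounded (Omega_closed L)"
    by (rule bounded_subset[of "{0..L} \<times> {0..L}"]) (auto simp: Omega_closed_def intro: bounded_Times)
  with cl show ?thesis by (simp add: compact_eq_bounded_closed)
qed

lemma Omega_closed_interior:
  assumes "0 < L" shows "interior (Omega_closed L) \<noteq> {}"
proof -
  have "{0<..<L/2} \<times> {L/2<..<L} \<subseteq> interior (Omega_closed L)"
    by (intro interior_maximal) (auto simp: Omega_closed_def open_Times)
  moreover have "(L/4, 3*L/4) \<in> {0<..<L/2} \<times> {L/2<..<L}" using assms by auto
  ultimately show ?thesis by blast
qed

text \<open>One point is chosen from each cell of a square grid that meets the triangle, so that the net lies in
  the triangle itself, where the kernel bounds are available.\<close>

lemma Omega_closed_net:
  assumes L: "0 < L" and s: "0 < s"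
  obtains F where "finite F" "F \<subseteq> Omega_closed L" "real (card F) \<le> (L / s + 1)\<^sup>2"
    "\<And>u. u \<in> Omega_closed L \<Longrightarrow> \<exists>v\<in>F. dist u v \<le> 2 * s"
proof -
  define N where "N = nat \<lfloor>L / s\<rfloor>"
  define cell where "cell u = (nat \<lfloor>fst u / s\<rfloor>, nat \<lfloor>snd u / s\<rfloor>)" for u :: "real \<times> real"
  define F where "F = inv_into (Omega_closed L) cell ` cell ` Omega_closed L"
  have sub: "cell ` Omega_closed L \<subseteq> {..N} \<times> {..N}"
    using s by (auto simp: cell_def N_def Omega_closed_def intro!: nat_mono floor_mono divide_right_mono)
  then have fin: "finite (cell ` Omega_closed L)" by (rule finite_subset) auto
  show thesis
  proof
    show "finite F" using fin by (simp add: F_def)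
    show "F \<subseteq> Omega_closed L" by (auto simp: F_def inv_into_into)
    have "card F \<le> card (cell ` Omega_closed L)" unfolding F_def by (rule card_image_le[OF fin])
    also have "\<dots> \<le> card ({..N} \<times> {..N})" by (rule card_mono[OF _ sub]) auto
    also have "\<dots> = (N + 1)\<^sup>2" by (simp add: power2_eq_square)
    finally have "real (card F) \<le> (real N + 1)\<^sup>2"
      by (metis of_nat_1 of_nat_add of_nat_le_iff of_nat_power)
    also have "\<dots> \<le> (L / s + 1)\<^sup>2"
      using L s by (intro power_mono) (auto simp: N_def intro: of_nat_floor)
    finally show "real (card F) \<le> (L / s + 1)\<^sup>2" .
    fix u assume u: "u \<in> Omega_closed L"
    define v where "v = inv_into (Omega_closed L) cell (cell u)"
    have v: "v \<in> Omega_closed L" "cell v = cell u"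
      using u by (auto simp: v_def inv_into_into f_inv_into_f)
    have *: "\<bar>a - b\<bar> \<le> s" if "0 \<le> a" "0 \<le> b" "nat \<lfloor>a / s\<rfloor> = nat \<lfloor>b / s\<rfloor>" for a b
    proof -
      have "\<lfloor>a / s\<rfloor> = \<lfloor>b / s\<rfloor>" using that s by (metis divide_nonneg_pos eq_nat_nat_iff zero_le_floor)
      then have "\<bar>a / s - b / s\<bar> \<le> 1" by linarith
      then show ?thesis using s by (simp add: diff_divide_distrib[symmetric] abs_divide)
    qed
    have "dist (fst u) (fst v) \<le> s" "dist (snd u) (snd v) \<le> s"
      using u v by (auto simp: dist_real_def cell_def Omega_closed_def intro!: *)
    moreover have "dist u v \<le> dist (fst u) (fst v) + dist (snd u) (snd v)"
      unfolding dist_prod_def by (rule sqrt_sum_squares_le_sum) auto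
    ultimately have "dist u v \<le> 2 * s" by linarith
    then show "\<exists>v\<in>F. dist u v \<le> 2 * s" using u by (auto simp: F_def v_def)
  qed
qed

section \<open>Boundary-normalised kernels\<close>

lemma smoothing_kernelD:
  assumes "smoothing_kernel K"
  shows smoothing_kernel_nonneg: "0 \<le> K x"
    and smoothing_kernel_support: "1 < norm x \<Longrightarrow> K x = 0"
    and smoothing_kernel_bounded: "\<exists>Q>0. \<forall>x. K x \<le> Q"
    and smoothing_kernel_lipschitz: "\<exists>C\<ge>0. \<forall>x y. \<bar>K x - K y\<bar> \<le> C * dist x y"
    and smoothing_kernel_positive: "\<exists>r>0. \<exists>k>0. \<forall>x. norm x \<le> r \<longrightarrow> k \<le> K x"
proof -
  show "0 \<le> K x" using assms by (simp add: smoothing_kernel_def)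
  show "1 < norm x \<Longrightarrow> K x = 0" using assms by (simp add: smoothing_kernel_def)
  obtain Q where "\<And>x. norm (K x) \<le> Q"
    using assms unfolding smoothing_kernel_def bounded_iff by blast
  then show "\<exists>Q>0. \<forall>x. K x \<le> Q"
    by (intro exI[of _ "max Q 1"]) (auto simp: le_max_iff_disj intro: order.trans[OF abs_ge_self])
  show "\<exists>C\<ge>0. \<forall>x y. \<bar>K x - K y\<bar> \<le> C * dist x y"
    using assms unfolding smoothing_kernel_def lipschitz_on_def dist_real_def by auto
  show "\<exists>r>0. \<exists>k>0. \<forall>x. norm x \<le> r \<longrightarrow> k \<le> K x"
    using assms unfolding smoothing_kernel_def by blast
qed

lemma smoothing_kernel_continuous:
  assumes "smoothing_kernel K"
  shows "continuous_on A K"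
  using assms continuous_on_subset[OF lipschitz_on_continuous_on]
  unfolding smoothing_kernel_def by blast

lemma scaled_kernel_continuous:
  assumes "smoothing_kernel K" "continuous_on A f" "continuous_on A g"
  shows "continuous_on A (\<lambda>p. scaled_kernel K h (f p) (g p))"
  unfolding scaled_kernel_def divide_inverse
  by (intro continuous_intros continuous_on_compose2[OF smoothing_kernel_continuous[OF assms(1), of UNIV]] assms) auto

lemma scaled_kernel_set_integrable:
  assumes "smoothing_kernel K" "compact S"
  shows "integrable lborel (\<lambda>y. indicator S y * scaled_kernel K h x y)"
  using borel_integrable_compact[OF assms(2) scaled_kernel_continuous[OF assms(1), of S "\<lambda>_. x" "\<lambda>y. y"]]
  by auto

lemma kernel_mass_eq: "kernel_mass S K h x = (\<integral>y. indicator S y * scaled_kernel K h x y \<partial>lborel)"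
  by (simp add: kernel_mass_def set_lebesgue_integral_def)

text \<open>The bound is independent of the bandwidth because the kernel is at least \<open>k / h ^ DIM('a)\<close> on a ball
  whose volume is a fixed multiple of \<open>h ^ DIM('a)\<close>.\<close>

lemma kernel_mass_lower_bound:
  fixes S :: "'a::euclidean_space set"
  assumes K: "smoothing_kernel K" and S: "compact S" "uniform_interior_balls S"
  obtains c h0 where "0 < c" "0 < h0"
    "\<And>h x. 0 < h \<Longrightarrow> h < h0 \<Longrightarrow> x \<in> S \<Longrightarrow> c \<le> kernel_mass S K h x"
proof -
  obtain r k where r: "0 < r" and k: "0 < k" "\<And>x. norm x \<le> r \<Longrightarrow> k \<le> K x"
    using smoothing_kernel_positive[OF K] by blast
  obtain a r0 where a: "0 < a" and r0: "0 < r0"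
    and ball: "\<And>x s. x \<in> S \<Longrightarrow> 0 < s \<Longrightarrow> s < r0 \<Longrightarrow> \<exists>y. ball y (a * s) \<subseteq> S \<inter> cball x s"
    using S(2) unfolding uniform_interior_balls_def by metis
  define c where "c = k * (unit_ball_vol DIM('a) * (a * r) ^ DIM('a))"
  show thesis
  proof
    show "0 < c" using k a r by (simp add: c_def unit_ball_vol_pos)
    show "0 < r0 / r" using r0 r by simp
    fix h x assume h: "0 < h" "h < r0 / r" and x: "x \<in> S"
    have "r * h < r0" using h r by (simp add: field_simps)
    then obtain y where y: "ball y (a * (r * h)) \<subseteq> S \<inter> cball x (r * h)"
      using ball[OF x, of "r * h"] r h by auto
    have fin: "emeasure lborel (ball y (a * (r * h))) < \<infinity>"
      by (intro emeasure_bounded_finite bounded_ball)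
    have "c = (\<integral>p. indicator (ball y (a * (r * h))) p * (k / h ^ DIM('a)) \<partial>lborel)"
      using a r h fin by (simp add: c_def content_ball power_mult_distrib)
    also have "\<dots> \<le> (\<integral>p. indicator S p * scaled_kernel K h x p \<partial>lborel)"
    proof (rule integral_mono)
      show "integrable lborel (\<lambda>p. indicator (ball y (a * (r * h))) p * (k / h ^ DIM('a)))"
        using fin by (intro integrable_mult_left integrable_real_indicator) auto
      show "integrable lborel (\<lambda>p. indicator S p * scaled_kernel K h x p)"
        by (rule scaled_kernel_set_integrable[OF K S(1)])
      fix p
      show "indicator (ball y (a * (r * h))) p * (k / h ^ DIM('a)) \<le> indicator S p * scaled_kernel K h x p"
      proof (cases "p \<in> ball y (a * (r * h))")
        case True
        then have p: "p \<in> S" "dist x p \<le> r * h" using y by auto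
        then have "norm (p - x) / h \<le> r"
          using h by (simp add: dist_norm norm_minus_commute divide_le_eq)
        then have "norm ((p - x) /\<^sub>R h) \<le> r" using h by (simp add: divide_inverse mult.commute)
        then have "k \<le> K ((p - x) /\<^sub>R h)" by (rule k)
        then show ?thesis using p h smoothing_kernel_nonneg[OF K]
          by (auto simp: scaled_kernel_def indicator_def intro!: divide_right_mono)
      next
        case False
        then show ?thesis using smoothing_kernel_nonneg[OF K] h
          by (auto simp: scaled_kernel_def indicator_def)
      qed
    qed
    finally show "c \<le> kernel_mass S K h x" by (simp add: kernel_mass_eq)
  qed
qed

lemma scaled_kernel_lipschitz:
  fixes x :: "'a::euclidean_space"
  assumes C: "\<And>x y. \<bar>K x - K y\<bar> \<le> C * dist x y" and h: "0 < h"
  shows "\<bar>scaled_kernel K h x y - scaled_kernel K h x' y\<bar> \<le> C / h ^ (DIM('a) + 1) * dist x x'"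
proof -
  have "(y - x) /\<^sub>R h - (y - x') /\<^sub>R h = (x' - x) /\<^sub>R h" by (simp add: algebra_simps)
  then have "dist ((y - x) /\<^sub>R h) ((y - x') /\<^sub>R h) = dist x x' / h"
    using h by (simp add: dist_norm norm_minus_commute divide_inverse mult.commute)
  then have "\<bar>K ((y - x) /\<^sub>R h) - K ((y - x') /\<^sub>R h)\<bar> \<le> C * (dist x x' / h)"
    using C by metis
  then have "\<bar>K ((y - x) /\<^sub>R h) - K ((y - x') /\<^sub>R h)\<bar> / h ^ DIM('a) \<le> C * (dist x x' / h) / h ^ DIM('a)"
    using h by (intro divide_right_mono) auto
  then show ?thesis using h by (simp add: scaled_kernel_def diff_divide_distrib[symmetric] mult.commute)
qed

lemma kernel_mass_lipschitz:
  fixes S :: "'a::euclidean_space set"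
  assumes K: "smoothing_kernel K" and S: "compact S"
    and C: "\<And>x y. \<bar>K x - K y\<bar> \<le> C * dist x y" and h: "0 < h"
  shows "\<bar>kernel_mass S K h x - kernel_mass S K h x'\<bar> \<le> C * measure lborel S / h ^ (DIM('a) + 1) * dist x x'"
proof -
  let ?c = "C / h ^ (DIM('a) + 1) * dist x x'"
  have fin: "emeasure lborel S < \<infinity>" using S by (intro emeasure_compact_finite)
  have [measurable]: "S \<in> sets borel" using S by (simp add: borel_closed compact_imp_closed)
  note int = scaled_kernel_set_integrable[OF K S]
  have "kernel_mass S K h x - kernel_mass S K h x'
      = (\<integral>y. indicator S y * scaled_kernel K h x y - indicator S y * scaled_kernel K h x' y \<partial>lborel)"
    unfolding kernel_mass_eq by (rule Bochner_Integration.integral_diff[symmetric]) (rule int)+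
  then have "\<bar>kernel_mass S K h x - kernel_mass S K h x'\<bar>
      \<le> (\<integral>y. \<bar>indicator S y * scaled_kernel K h x y - indicator S y * scaled_kernel K h x' y\<bar> \<partial>lborel)"
    using integral_abs_bound by metis
  also have "\<dots> \<le> (\<integral>y. indicator S y * ?c \<partial>lborel)"
  proof (rule integral_mono)
    show "integrable lborel (\<lambda>y. indicator S y * ?c)"
      using fin by (intro integrable_mult_left integrable_real_indicator) auto
    show "integrable lborel (\<lambda>y. \<bar>indicator S y * scaled_kernel K h x y - indicator S y * scaled_kernel K h x' y\<bar>)"
      by (intro integrable_abs Bochner_Integration.integrable_diff int)
    show "\<bar>indicator S y * scaled_kernel K h x y - indicator S y * scaled_kernel K h x' y\<bar> \<le> indicator S y * ?c" for y
      using scaled_kernel_lipschitz[of K C h x y x', OF C h] by (simp add: indicator_def)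
  qed
  also have "\<dots> = C * measure lborel S / h ^ (DIM('a) + 1) * dist x x'"
    using fin by simp
  finally show ?thesis .
qed

lemma kernel_mass_continuous:
  assumes K: "smoothing_kernel K" and S: "compact S" and h: "0 < h"
  shows "continuous_on A (kernel_mass S K h)"
proof -
  obtain C where C: "0 \<le> C" "\<And>x y. \<bar>K x - K y\<bar> \<le> C * dist x y"
    using smoothing_kernel_lipschitz[OF K] by blast
  have "(C * measure lborel S / h ^ (DIM('a) + 1))-lipschitz_on UNIV (kernel_mass S K h)"
    using kernel_mass_lipschitz[OF K S C(2) h] C(1) h
    by (intro lipschitz_onI) (auto simp: dist_real_def)
  then show ?thesis by (rule continuous_on_subset[OF lipschitz_on_continuous_on]) auto
qed

lemma normalized_kernel_support:
  assumes K: "smoothing_kernel K" and h: "0 < h" and nz: "normalized_kernel S K h x y \<noteq> 0"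
  shows "dist x y \<le> h"
proof -
  have "K ((y - x) /\<^sub>R h) \<noteq> 0" using nz by (auto simp: normalized_kernel_def scaled_kernel_def)
  then have "norm ((y - x) /\<^sub>R h) \<le> 1" using smoothing_kernel_support[OF K] by (meson not_le)
  then have "norm (y - x) / h \<le> 1" using h by (simp only: norm_scaleR) (simp add: divide_inverse mult.commute)
  then show ?thesis using h by (simp add: dist_norm norm_minus_commute)
qed

lemma normalized_kernel_nonneg:
  assumes K: "smoothing_kernel K" and h: "0 < h"
  shows "0 \<le> normalized_kernel S K h x y"
proof -
  have s: "0 \<le> scaled_kernel K h x y" for y
    using smoothing_kernel_nonneg[OF K] h by (simp add: scaled_kernel_def)
  then have "0 \<le> kernel_mass S K h x"
    unfolding kernel_mass_eq by (intro integral_nonneg_AE) auto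
  with s show ?thesis by (simp add: normalized_kernel_def)
qed

lemma nn_integral_normalized_kernel:
  assumes K: "smoothing_kernel K" and S: "compact S" and h: "0 < h" and pos: "0 < kernel_mass S K h x"
  shows "(\<integral>\<^sup>+y. ennreal (normalized_kernel S K h x y) \<partial>restrict_space lborel S) = 1"
proof -
  have [measurable]: "S \<in> sets borel" using S by (simp add: borel_closed compact_imp_closed)
  have i: "integrable lborel (\<lambda>y. indicator S y * scaled_kernel K h x y / kernel_mass S K h x)"
    by (intro integrable_divide scaled_kernel_set_integrable[OF K S])
  have "(\<integral>\<^sup>+y. ennreal (normalized_kernel S K h x y) \<partial>restrict_space lborel S)
     = (\<integral>\<^sup>+y. ennreal (normalized_kernel S K h x y) * indicator S y \<partial>lborel)"
    by (subst nn_integral_restrict_space) auto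
  also have "\<dots> = (\<integral>\<^sup>+y. ennreal (indicator S y * scaled_kernel K h x y / kernel_mass S K h x) \<partial>lborel)"
    by (intro nn_integral_cong) (auto simp: indicator_def normalized_kernel_def)
  also have "\<dots> = ennreal (\<integral>y. indicator S y * scaled_kernel K h x y / kernel_mass S K h x \<partial>lborel)"
    using smoothing_kernel_nonneg[OF K] h pos
    by (intro nn_integral_eq_integral[OF i]) (auto simp: scaled_kernel_def)
  also have "\<dots> = 1" using pos by (simp add: kernel_mass_eq[symmetric])
  finally show ?thesis .
qed

text \<open>The powers of \<open>h\<close> in the Lipschitz bound are not sharp. Any polynomial in \<open>1 / h\<close> serves, since the
  Lipschitz constant only determines the size of a net and hence enters logarithmically.\<close>

lemma normalized_kernel_uniform_bounds:
  fixes S :: "'a::euclidean_space set"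
  assumes K: "smoothing_kernel K" and S: "compact S" "uniform_interior_balls S"
  obtains Q h0 where "0 < Q" "0 < h0" "h0 \<le> 1"
    "\<And>h x. 0 < h \<Longrightarrow> h < h0 \<Longrightarrow> x \<in> S \<Longrightarrow> 0 < kernel_mass S K h x"
    "\<And>h x y. 0 < h \<Longrightarrow> h < h0 \<Longrightarrow> x \<in> S \<Longrightarrow> normalized_kernel S K h x y \<le> Q / h ^ DIM('a)"
    "\<And>h x x' y. 0 < h \<Longrightarrow> h < h0 \<Longrightarrow> x \<in> S \<Longrightarrow> x' \<in> S \<Longrightarrow>
       \<bar>normalized_kernel S K h x y - normalized_kernel S K h x' y\<bar> \<le> Q / h ^ (2 * DIM('a) + 1) * dist x x'"
proof -
  obtain c h1 where c: "0 < c" and h1: "0 < h1"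
    and low: "\<And>h x. 0 < h \<Longrightarrow> h < h1 \<Longrightarrow> x \<in> S \<Longrightarrow> c \<le> kernel_mass S K h x"
    using kernel_mass_lower_bound[OF K S] by blast
  obtain C where C: "0 \<le> C" "\<And>x y. \<bar>K x - K y\<bar> \<le> C * dist x y"
    using smoothing_kernel_lipschitz[OF K] by blast
  obtain Km where Km: "0 < Km" "\<And>x. K x \<le> Km" using smoothing_kernel_bounded[OF K] by blast
  define V where "V = measure lborel S"
  define Q where "Q = Km / c + (C / c + Km * C * V / c\<^sup>2)"
  have Q1: "0 < Km / c" "0 \<le> C / c + Km * C * V / c\<^sup>2"
    using Km c C by (auto simp: V_def intro!: add_nonneg_nonneg)
  show thesis
  proof
    show "0 < Q" using Q1 by (simp add: Q_def)
    show "0 < min h1 1" "min h1 1 \<le> 1" using h1 by auto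
    fix h :: real and x assume h: "0 < h" "h < min h1 1" and x: "x \<in> S"
    have m: "c \<le> kernel_mass S K h x" using low h x by auto
    then show "0 < kernel_mass S K h x" using c by linarith
    have sk: "0 \<le> scaled_kernel K h x y" "scaled_kernel K h x y \<le> Km / h ^ DIM('a)" for x y
      using smoothing_kernel_nonneg[OF K] Km h by (auto simp: scaled_kernel_def intro!: divide_right_mono)
    {
      fix y
      have "normalized_kernel S K h x y \<le> (Km / h ^ DIM('a)) / c"
        unfolding normalized_kernel_def using sk[of x y] m c by (intro frac_le) auto
      also have "\<dots> = (Km / c) / h ^ DIM('a)" by simp
      also have "\<dots> \<le> Q / h ^ DIM('a)" using Q1 h by (intro divide_right_mono) (auto simp: Q_def)
      finally show "normalized_kernel S K h x y \<le> Q / h ^ DIM('a)" .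
    }
    fix x' y assume x': "x' \<in> S"
    have m': "c \<le> kernel_mass S K h x'" using low h x' by auto
    let ?a = "scaled_kernel K h x y" and ?a' = "scaled_kernel K h x' y"
    let ?m = "kernel_mass S K h x" and ?m' = "kernel_mass S K h x'"
    let ?d = "DIM('a)"
    have pos: "0 < ?m" "0 < ?m'" using m m' c by auto
    have split: "?a / ?m - ?a' / ?m' = (?a - ?a') / ?m + ?a' * (?m' - ?m) / (?m * ?m')"
      using pos by (simp add: field_simps)
    have "\<bar>?a / ?m - ?a' / ?m'\<bar> \<le> \<bar>?a - ?a'\<bar> / ?m + ?a' * \<bar>?m' - ?m\<bar> / (?m * ?m')"
      unfolding split using pos sk by (intro order.trans[OF abs_triangle_ineq]) (simp add: abs_mult)
    also have "\<dots> \<le> (C / h ^ (?d + 1) * dist x x') / c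
        + (Km / h ^ ?d) * (C * V / h ^ (?d + 1) * dist x x') / (c * c)"
    proof (intro add_mono frac_le mult_mono)
      show "\<bar>?a - ?a'\<bar> \<le> C / h ^ (?d + 1) * dist x x'"
        by (rule scaled_kernel_lipschitz[OF C(2) h(1)])
      show "\<bar>?m' - ?m\<bar> \<le> C * V / h ^ (?d + 1) * dist x x'"
        unfolding V_def using kernel_mass_lipschitz[OF K S(1) C(2) h(1), of x' x] by (simp add: dist_commute)
    qed (use m m' c sk C Km h in \<open>auto simp: V_def intro!: mult_nonneg_nonneg divide_nonneg_nonneg\<close>)
    also have "\<dots> = (C / c) / h ^ (?d + 1) * dist x x' + (Km * C * V / c\<^sup>2) / h ^ (2 * ?d + 1) * dist x x'"
      by (simp add: power2_eq_square power_add power_even_eq power_mult_distrib mult_2 mult_ac flip: power_add) (simp add: mult_2_right power_add)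
    also have "\<dots> \<le> (C / c) / h ^ (2 * ?d + 1) * dist x x' + (Km * C * V / c\<^sup>2) / h ^ (2 * ?d + 1) * dist x x'"
      using h c C by (intro add_right_mono mult_right_mono divide_left_mono power_decreasing) auto
    also have "\<dots> = (C / c + Km * C * V / c\<^sup>2) / h ^ (2 * ?d + 1) * dist x x'"
      by (simp add: add_divide_distrib distrib_right)
    also have "\<dots> \<le> Q / h ^ (2 * ?d + 1) * dist x x'"
      using Q1 h by (intro mult_right_mono divide_right_mono) (auto simp: Q_def)
    finally show "\<bar>normalized_kernel S K h x y - normalized_kernel S K h x' y\<bar> \<le> Q / h ^ (2 * ?d + 1) * dist x x'"
      by (simp add: normalized_kernel_def)
  qed
qed

section \<open>Integrals against random diagrams\<close>

text \<open>Proved by induction over \<open>f\<close> for arbitrary measures, because diagrams may accumulate at the diagonal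
  and their unweighted measures are then infinite.\<close>

lemma borel_measurable_nn_integral_family:
  fixes \<mu> :: "'a \<Rightarrow> 'b measure"
  assumes sets: "\<And>\<omega>. \<omega> \<in> space M \<Longrightarrow> sets (\<mu> \<omega>) = sets N"
    and meas: "\<And>A. A \<in> sets N \<Longrightarrow> (\<lambda>\<omega>. emeasure (\<mu> \<omega>) A) \<in> borel_measurable M"
    and f: "f \<in> borel_measurable N"
  shows "(\<lambda>\<omega>. \<integral>\<^sup>+v. f v \<partial>\<mu> \<omega>) \<in> borel_measurable M"
proof -
  have space: "space (\<mu> \<omega>) = space N" if "\<omega> \<in> space M" for \<omega>
    using sets_eq_imp_space_eq[OF sets[OF that]] .
  have mN: "h \<in> borel_measurable (\<mu> \<omega>)" if "h \<in> borel_measurable N" "\<omega> \<in> space M" for \<omega> and h :: "'b \<Rightarrow> ennreal"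
    using that(1) measurable_cong_sets[OF sets[OF that(2)] refl, of borel] by auto
  have cong': "Y \<in> borel_measurable M"
    if "X \<in> borel_measurable M" "\<And>\<omega>. \<omega> \<in> space M \<Longrightarrow> Y \<omega> = X \<omega>" for X Y :: "'a \<Rightarrow> ennreal"
    using that measurable_cong[of M Y X] by simp
  show ?thesis using f
  proof (induct rule: borel_measurable_induct)
    case (cong f g)
    then have "(\<integral>\<^sup>+v. f v \<partial>\<mu> \<omega>) = (\<integral>\<^sup>+v. g v \<partial>\<mu> \<omega>)" if "\<omega> \<in> space M" for \<omega>
      using space[OF that] by (intro nn_integral_cong) auto
    then show ?case by (rule cong'[OF cong(4)])
  next
    case (set A)
    then have "(\<integral>\<^sup>+v. indicator A v \<partial>\<mu> \<omega>) = emeasure (\<mu> \<omega>) A" if "\<omega> \<in> space M" for \<omega>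
      using sets[OF that] by simp
    then show ?case by (rule cong'[OF meas[OF set]])
  next
    case (mult u c)
    have "(\<integral>\<^sup>+v. c * u v \<partial>\<mu> \<omega>) = c * (\<integral>\<^sup>+v. u v \<partial>\<mu> \<omega>)" if "\<omega> \<in> space M" for \<omega>
      by (rule nn_integral_cmult[OF mN[OF mult(2) that]])
    then show ?case by (rule cong'[OF borel_measurable_times_ennreal[OF borel_measurable_const mult(4)]])
  next
    case (add u v)
    have "(\<integral>\<^sup>+x. v x + u x \<partial>\<mu> \<omega>) = (\<integral>\<^sup>+x. v x \<partial>\<mu> \<omega>) + (\<integral>\<^sup>+x. u x \<partial>\<mu> \<omega>)" if "\<omega> \<in> space M" for \<omega>
      by (rule nn_integral_add[OF mN[OF add(4) that] mN[OF add(1) that]])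
    then show ?case by (rule cong'[OF borel_measurable_add[OF add(7) add(3)]])
  next
    case (seq U)
    have "(\<integral>\<^sup>+x. (SUP i. U i) x \<partial>\<mu> \<omega>) = (SUP i. \<integral>\<^sup>+x. U i x \<partial>\<mu> \<omega>)" if "\<omega> \<in> space M" for \<omega>
      unfolding SUP_apply by (rule nn_integral_monotone_convergence_SUP[OF seq(4) mN[OF seq(1) that]])
    then show ?case by (rule cong'[OF borel_measurable_SUP[OF countableI_type seq(3)]])
  qed
qed

text \<open>Extends an identity between two random measures from sets to functions, with a random factor \<open>G\<close>
  kept outside. This is how the setwise definition of the conditional intensity is used on kernels.\<close>

lemma nn_integral_family_eqI:
  fixes \<mu> \<nu> :: "'a \<Rightarrow> 'b measure"
  assumes sets: "\<And>\<omega>. \<omega> \<in> space M \<Longrightarrow> sets (\<mu> \<omega>) = sets N" "\<And>\<omega>. \<omega> \<in> space M \<Longrightarrow> sets (\<nu> \<omega>) = sets N"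
    and meas: "\<And>A. A \<in> sets N \<Longrightarrow> (\<lambda>\<omega>. emeasure (\<mu> \<omega>) A) \<in> borel_measurable M"
      "\<And>A. A \<in> sets N \<Longrightarrow> (\<lambda>\<omega>. emeasure (\<nu> \<omega>) A) \<in> borel_measurable M"
    and G[measurable]: "G \<in> borel_measurable M"
    and eq: "\<And>A. A \<in> sets N \<Longrightarrow> (\<integral>\<^sup>+\<omega>. G \<omega> * emeasure (\<mu> \<omega>) A \<partial>M) = (\<integral>\<^sup>+\<omega>. G \<omega> * emeasure (\<nu> \<omega>) A \<partial>M)"
    and f: "f \<in> borel_measurable N"
  shows "(\<integral>\<^sup>+\<omega>. G \<omega> * (\<integral>\<^sup>+v. f v \<partial>\<mu> \<omega>) \<partial>M) = (\<integral>\<^sup>+\<omega>. G \<omega> * (\<integral>\<^sup>+v. f v \<partial>\<nu> \<omega>) \<partial>M)"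
proof -
  have space: "space (\<mu> \<omega>) = space N" "space (\<nu> \<omega>) = space N" if "\<omega> \<in> space M" for \<omega>
    using sets_eq_imp_space_eq[OF sets(1)[OF that]] sets_eq_imp_space_eq[OF sets(2)[OF that]] .
  have mN: "h \<in> borel_measurable (\<mu> \<omega>)" "h \<in> borel_measurable (\<nu> \<omega>)"
    if "h \<in> borel_measurable N" "\<omega> \<in> space M" for \<omega> and h :: "'b \<Rightarrow> ennreal"
    using that(1) measurable_cong_sets[OF sets(1)[OF that(2)] refl, of borel]
      measurable_cong_sets[OF sets(2)[OF that(2)] refl, of borel] by auto
  have mi[measurable]: "(\<lambda>\<omega>. \<integral>\<^sup>+v. h v \<partial>\<mu> \<omega>) \<in> borel_measurable M" "(\<lambda>\<omega>. \<integral>\<^sup>+v. h v \<partial>\<nu> \<omega>) \<in> borel_measurable M"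
    if "h \<in> borel_measurable N" for h :: "'b \<Rightarrow> ennreal"
    using borel_measurable_nn_integral_family[OF sets(1) meas(1) that]
      borel_measurable_nn_integral_family[OF sets(2) meas(2) that] by auto
  let ?I = "\<lambda>\<kappa> f. \<integral>\<^sup>+\<omega>. G \<omega> * (\<integral>\<^sup>+v. f v \<partial>\<kappa> \<omega>) \<partial>M"
  show ?thesis using f
  proof (induct rule: borel_measurable_induct)
    case (cong f g)
    have "?I \<mu> f = ?I \<mu> g" "?I \<nu> f = ?I \<nu> g"
      using cong(3) space by (auto intro!: nn_integral_cong arg_cong2[where f="(*)"])
    then show ?case using cong by simp
  next
    case (set A)
    have "?I \<mu> (indicator A) = (\<integral>\<^sup>+\<omega>. G \<omega> * emeasure (\<mu> \<omega>) A \<partial>M)"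
      "?I \<nu> (indicator A) = (\<integral>\<^sup>+\<omega>. G \<omega> * emeasure (\<nu> \<omega>) A \<partial>M)"
      using set sets by (auto intro!: nn_integral_cong)
    then show ?case using eq[OF set] by simp
  next
    case (mult u c)
    have "?I \<kappa> (\<lambda>x. c * u x) = c * ?I \<kappa> u"
      if k: "\<And>\<omega>. \<omega> \<in> space M \<Longrightarrow> u \<in> borel_measurable (\<kappa> \<omega>)"
         "(\<lambda>\<omega>. \<integral>\<^sup>+v. u v \<partial>\<kappa> \<omega>) \<in> borel_measurable M"
      for \<kappa> :: "'a \<Rightarrow> 'b measure"
    proof -
      have "?I \<kappa> (\<lambda>x. c * u x) = (\<integral>\<^sup>+\<omega>. c * (G \<omega> * (\<integral>\<^sup>+v. u v \<partial>\<kappa> \<omega>)) \<partial>M)"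
        by (intro nn_integral_cong) (simp add: nn_integral_cmult[OF k(1)] mult.left_commute)
      also have "\<dots> = c * ?I \<kappa> u" by (rule nn_integral_cmult[OF borel_measurable_times_ennreal[OF G k(2)]])
      finally show ?thesis .
    qed
    from this[OF mN(1) mi(1)] this[OF mN(2) mi(2)] show ?case using mult by simp
  next
    case (add u v)
    have "?I \<kappa> (\<lambda>x. v x + u x) = ?I \<kappa> v + ?I \<kappa> u"
      if k: "\<And>\<omega>. \<omega> \<in> space M \<Longrightarrow> v \<in> borel_measurable (\<kappa> \<omega>)" "\<And>\<omega>. \<omega> \<in> space M \<Longrightarrow> u \<in> borel_measurable (\<kappa> \<omega>)"
         "(\<lambda>\<omega>. \<integral>\<^sup>+x. v x \<partial>\<kappa> \<omega>) \<in> borel_measurable M" "(\<lambda>\<omega>. \<integral>\<^sup>+x. u x \<partial>\<kappa> \<omega>) \<in> borel_measurable M"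
      for \<kappa> :: "'a \<Rightarrow> 'b measure"
    proof -
      have "?I \<kappa> (\<lambda>x. v x + u x)
          = (\<integral>\<^sup>+\<omega>. G \<omega> * (\<integral>\<^sup>+x. v x \<partial>\<kappa> \<omega>) + G \<omega> * (\<integral>\<^sup>+x. u x \<partial>\<kappa> \<omega>) \<partial>M)"
        by (intro nn_integral_cong) (simp add: nn_integral_add[OF k(1,2)] distrib_left)
      also have "\<dots> = ?I \<kappa> v + ?I \<kappa> u"
        by (rule nn_integral_add[OF borel_measurable_times_ennreal[OF G k(3)] borel_measurable_times_ennreal[OF G k(4)]])
      finally show ?thesis .
    qed
    from this[OF mN(1) mN(1) mi(1) mi(1)] this[OF mN(2) mN(2) mi(2) mi(2)] show ?case using add by simp
  next
    case (seq U)
    have "?I \<kappa> (SUP i. U i) = (SUP i. ?I \<kappa> (U i))"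
      if k: "\<And>(h :: 'b \<Rightarrow> ennreal) \<omega>. h \<in> borel_measurable N \<Longrightarrow> \<omega> \<in> space M \<Longrightarrow> h \<in> borel_measurable (\<kappa> \<omega>)"
         "\<And>h :: 'b \<Rightarrow> ennreal. h \<in> borel_measurable N \<Longrightarrow> (\<lambda>\<omega>. \<integral>\<^sup>+v. h v \<partial>\<kappa> \<omega>) \<in> borel_measurable M"
      for \<kappa> :: "'a \<Rightarrow> 'b measure"
    proof -
      have "?I \<kappa> (SUP i. U i) = (\<integral>\<^sup>+\<omega>. (SUP i. G \<omega> * (\<integral>\<^sup>+v. U i v \<partial>\<kappa> \<omega>)) \<partial>M)"
      proof (intro nn_integral_cong)
        fix \<omega> assume "\<omega> \<in> space M"
        then have "(\<integral>\<^sup>+x. (SUP i. U i) x \<partial>\<kappa> \<omega>) = (SUP i. \<integral>\<^sup>+x. U i x \<partial>\<kappa> \<omega>)"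
          unfolding SUP_apply by (intro nn_integral_monotone_convergence_SUP seq(4) k(1) seq(1))
        then show "G \<omega> * (\<integral>\<^sup>+x. (SUP i. U i) x \<partial>\<kappa> \<omega>) = (SUP i. G \<omega> * (\<integral>\<^sup>+v. U i v \<partial>\<kappa> \<omega>))"
          by (simp add: SUP_mult_left_ennreal)
      qed
      also have "\<dots> = (SUP i. ?I \<kappa> (U i))"
      proof (rule nn_integral_monotone_convergence_SUP)
        show "incseq (\<lambda>i \<omega>. G \<omega> * (\<integral>\<^sup>+v. U i v \<partial>\<kappa> \<omega>))"
          using seq(4) by (auto simp: incseq_def le_fun_def intro!: mult_left_mono nn_integral_mono)
        show "(\<lambda>\<omega>. G \<omega> * (\<integral>\<^sup>+v. U i v \<partial>\<kappa> \<omega>)) \<in> borel_measurable M" for i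
          by (rule borel_measurable_times_ennreal[OF G k(2)[OF seq(1)]])
      qed
      finally show ?thesis .
    qed
    from this[OF mN(1) mi(1)] this[OF mN(2) mi(2)] show ?case by (simp only: seq(3))
  qed
qed

lemma space_diagram_space: "space (diagram_space L) = diagrams L"
  unfolding diagram_space_def by (rule space_measure_of) auto

lemma sets_diagram_measure [simp]:
  "sets (diagram_measure L a) = sets (restrict_space borel (Omega_closed L))"
  by (simp add: diagram_measure_def)

lemma sets_weighted_diagram_measure [simp]:
  "sets (weighted_diagram_measure L w a) = sets (restrict_space borel (Omega_closed L))"
  by (simp add: weighted_diagram_measure_def)

lemma space_weighted_diagram_measure [simp]: "space (weighted_diagram_measure L w a) = Omega_closed L"
  using sets_eq_imp_space_eq[OF sets_weighted_diagram_measure] by (simp add: space_restrict_space)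

lemma measurable_emeasure_diagram_measure:
  assumes A: "A \<in> sets (restrict_space borel (Omega_closed L))"
  shows "(\<lambda>a. emeasure (diagram_measure L a) A) \<in> borel_measurable (diagram_space L)"
proof (rule measurableI)
  fix S :: "ennreal set" assume S: "S \<in> sets borel"
  show "(\<lambda>a. emeasure (diagram_measure L a) A) -` S \<inter> space (diagram_space L) \<in> sets (diagram_space L)"
    unfolding space_diagram_space unfolding diagram_space_def using A S
    by (subst sets_measure_of) (auto intro!: sigma_sets.Basic)
qed auto

lemma nn_integral_weighted_diagram_measure:
  assumes w: "weight L w" and f: "f \<in> borel_measurable (restrict_space borel (Omega_closed L))"
  shows "(\<integral>\<^sup>+v. f v \<partial>weighted_diagram_measure L w a) = (\<integral>\<^sup>+v. ennreal (w v) * f v \<partial>diagram_measure L a)"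
proof -
  have "(\<lambda>v. ennreal (w v)) \<in> borel_measurable (diagram_measure L a)"
    unfolding measurable_cong_sets[OF sets_diagram_measure refl]
    using w unfolding weight_def by (intro measurable_compose[OF _ measurable_ennreal]) auto
  moreover have "f \<in> borel_measurable (diagram_measure L a)"
    using f unfolding measurable_cong_sets[OF sets_diagram_measure refl] .
  ultimately show ?thesis unfolding weighted_diagram_measure_def by (intro nn_integral_density) auto
qed

lemma measurable_nn_integral_weighted_diagram_measure:
  assumes w: "weight L w" and f: "f \<in> borel_measurable (restrict_space borel (Omega_closed L))"
  shows "(\<lambda>a. \<integral>\<^sup>+v. f v \<partial>weighted_diagram_measure L w a) \<in> borel_measurable (diagram_space L)"
proof -
  have [measurable]: "w \<in> borel_measurable (restrict_space borel (Omega_closed L))"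
    using w by (simp add: weight_def)
  show ?thesis unfolding nn_integral_weighted_diagram_measure[OF w f]
    using f by (intro borel_measurable_nn_integral_family[where N="restrict_space borel (Omega_closed L)"]
        measurable_emeasure_diagram_measure) auto
qed

lemma measurable_emeasure_weighted_diagram_measure:
  assumes w: "weight L w" and A: "A \<in> sets (restrict_space borel (Omega_closed L))"
  shows "(\<lambda>a. emeasure (weighted_diagram_measure L w a) A) \<in> borel_measurable (diagram_space L)"
  using measurable_nn_integral_weighted_diagram_measure[OF w, of "indicator A"] A by simp

text \<open>Under the expectation, and against any function of the covariate, the weighted diagram measure may
  be replaced by its conditional intensity.\<close>

lemma nn_integral_conditional_intensity:
  assumes M: "prob_space M" and w: "weight L w"
    and \<Lambda>: "conditional_intensity M ZZ L w Z D \<Lambda>"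
    and Z[measurable]: "Z \<in> M \<rightarrow>\<^sub>M restrict_space borel ZZ" and D[measurable]: "D \<in> M \<rightarrow>\<^sub>M diagram_space L"
    and g[measurable]: "g \<in> borel_measurable (restrict_space borel ZZ)"
    and f: "f \<in> borel_measurable (restrict_space borel (Omega_closed L))"
  shows "(\<integral>\<^sup>+\<omega>. g (Z \<omega>) * (\<integral>\<^sup>+v. f v \<partial>weighted_diagram_measure L w (D \<omega>)) \<partial>M)
       = (\<integral>\<^sup>+\<omega>. g (Z \<omega>) * (\<integral>\<^sup>+v. f v \<partial>\<Lambda> (Z \<omega>)) \<partial>M)"
proof -
  interpret prob_space M by fact
  let ?F = "vimage_algebra (space M) Z (restrict_space borel ZZ)"
  let ?N = "restrict_space borel (Omega_closed L)"
  have ZZ: "Z \<omega> \<in> ZZ" if "\<omega> \<in> space M" for \<omega>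
    using measurable_space[OF Z that] by (simp add: space_restrict_space)
  have "subalgebra M ?F"
    using Z unfolding subalgebra_def measurable_iff_sets by simp
  then interpret F: finite_measure_subalgebra M ?F by unfold_locales
  have gF: "(\<lambda>\<omega>. g (Z \<omega>)) \<in> borel_measurable ?F"
    by (rule measurable_compose[OF measurable_vimage_algebra1 g]) (use ZZ in \<open>auto simp: space_restrict_space\<close>)
  have meas: "(\<lambda>\<omega>. emeasure (weighted_diagram_measure L w (D \<omega>)) A) \<in> borel_measurable M"
    if "A \<in> sets ?N" for A
    by (rule measurable_compose[OF D measurable_emeasure_weighted_diagram_measure[OF w that]])
  have \<Lambda>A: "(\<lambda>z. emeasure (\<Lambda> z) A) \<in> borel_measurable (restrict_space borel ZZ)"
    "AE \<omega> in M. nn_cond_exp M ?F (\<lambda>\<omega>. emeasure (weighted_diagram_measure L w (D \<omega>)) A) \<omega> = emeasure (\<Lambda> (Z \<omega>)) A"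
    if "A \<in> sets ?N" for A
    using \<Lambda> that unfolding conditional_intensity_def by auto
  show ?thesis
  proof (rule nn_integral_family_eqI[where N="?N"])
    show "sets (\<Lambda> (Z \<omega>)) = sets ?N" if "\<omega> \<in> space M" for \<omega>
      using \<Lambda> ZZ[OF that] unfolding conditional_intensity_def by blast
    show "(\<lambda>\<omega>. emeasure (\<Lambda> (Z \<omega>)) A) \<in> borel_measurable M" if "A \<in> sets ?N" for A
      by (rule measurable_compose[OF Z \<Lambda>A(1)[OF that]])
    show "(\<integral>\<^sup>+\<omega>. g (Z \<omega>) * emeasure (weighted_diagram_measure L w (D \<omega>)) A \<partial>M)
        = (\<integral>\<^sup>+\<omega>. g (Z \<omega>) * emeasure (\<Lambda> (Z \<omega>)) A \<partial>M)" if "A \<in> sets ?N" for A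
    proof -
      have "(\<integral>\<^sup>+\<omega>. g (Z \<omega>) * emeasure (\<Lambda> (Z \<omega>)) A \<partial>M) = (\<integral>\<^sup>+\<omega>. g (Z \<omega>) *
          nn_cond_exp M ?F (\<lambda>\<omega>. emeasure (weighted_diagram_measure L w (D \<omega>)) A) \<omega> \<partial>M)"
        using \<Lambda>A(2)[OF that] by (intro nn_integral_cong_AE) auto
      also have "\<dots> = (\<integral>\<^sup>+\<omega>. g (Z \<omega>) * emeasure (weighted_diagram_measure L w (D \<omega>)) A \<partial>M)"
        by (rule F.nn_cond_exp_intg[OF gF meas[OF that]])
      finally show ?thesis by simp
    qed
  qed (use meas f in auto)
qed

section \<open>The estimator at fixed bandwidths\<close>

lemma normalized_kernel_continuous:
  assumes "smoothing_kernel K" "continuous_on A f" "continuous_on A g" "compact S" "0 < h"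
    "\<And>p. p \<in> A \<Longrightarrow> kernel_mass S K h (f p) \<noteq> 0"
  shows "continuous_on A (\<lambda>p. normalized_kernel S K h (f p) (g p))"
  unfolding normalized_kernel_def
  by (intro continuous_intros scaled_kernel_continuous assms
      continuous_on_compose2[OF kernel_mass_continuous[OF assms(1,4,5), of UNIV]]) (use assms in auto)

text \<open>The sample at one fixed pair of bandwidths \<open>h\<close>, \<open>k\<close> for the covariate and the diagram plane. The
  constants \<open>QZ\<close>, \<open>QU\<close>, \<open>Mw\<close>, \<open>lmax\<close> do not depend on the bandwidths in the application, which is why
  the powers of \<open>h\<close> and \<open>k\<close> are displayed separately. With \<open>QU\<close>, \<open>Mw\<close> and \<open>lmax\<close> at least one, a
  single bound dominates the terms of both averages, and a single multiple of \<open>D\<^sub>h\<close> their means.\<close>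

locale smoothed_sample = prob_space M
  for M :: "'a measure" +
  fixes L :: real and ZZ :: "'z::euclidean_space set"
    and Zs :: "nat \<Rightarrow> 'a \<Rightarrow> 'z" and Ds :: "nat \<Rightarrow> 'a \<Rightarrow> diagram"
    and w :: "real \<times> real \<Rightarrow> real" and KZ :: "'z \<Rightarrow> real" and KU :: "real \<times> real \<Rightarrow> real"
    and \<Lambda> :: "'z \<Rightarrow> (real \<times> real) measure" and lam :: "'z \<Rightarrow> real \<times> real \<Rightarrow> real"
    and h k QZ QU Mw lmax :: real
  assumes L_pos: "0 < L" and ZZ_compact: "compact ZZ"
    and indep: "indep_vars (\<lambda>_. restrict_space borel ZZ \<Otimes>\<^sub>M diagram_space L) (\<lambda>i \<omega>. (Zs i \<omega>, Ds i \<omega>)) UNIV"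
    and ident: "\<And>i. distr M (restrict_space borel ZZ \<Otimes>\<^sub>M diagram_space L) (\<lambda>\<omega>. (Zs i \<omega>, Ds i \<omega>))
        = distr M (restrict_space borel ZZ \<Otimes>\<^sub>M diagram_space L) (\<lambda>\<omega>. (Zs 0 \<omega>, Ds 0 \<omega>))"
    and w: "weight L w" and KZ: "smoothing_kernel KZ" and KU: "smoothing_kernel KU"
    and h: "0 < h" and k: "0 < k" "k \<le> 1"
    and massZ: "\<And>z. z \<in> ZZ \<Longrightarrow> 0 < kernel_mass ZZ KZ h z"
    and massU: "\<And>u. u \<in> Omega_closed L \<Longrightarrow> 0 < kernel_mass (Omega_closed L) KU k u"
    and boundZ: "\<And>z z'. z \<in> ZZ \<Longrightarrow> normalized_kernel ZZ KZ h z z' \<le> QZ / h ^ DIM('z)"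
    and boundU: "\<And>u v. u \<in> Omega_closed L \<Longrightarrow> normalized_kernel (Omega_closed L) KU k u v \<le> QU / k\<^sup>2"
    and lipU: "\<And>u u' v. u \<in> Omega_closed L \<Longrightarrow> u' \<in> Omega_closed L \<Longrightarrow>
       \<bar>normalized_kernel (Omega_closed L) KU k u v - normalized_kernel (Omega_closed L) KU k u' v\<bar> \<le> QU / k ^ 5 * dist u u'"
    and const_bounds: "0 < QZ" "1 \<le> QU" "1 \<le> Mw" "1 \<le> lmax"
    and \<Lambda>: "\<And>i. conditional_intensity M ZZ L w (Zs i) (Ds i) \<Lambda>"
    and \<Lambda>_density: "\<And>z. z \<in> ZZ \<Longrightarrow>
        \<Lambda> z = density (restrict_space lborel (Omega_closed L)) (\<lambda>u. ennreal (lam z u))"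
    and lam_nonneg: "\<And>z u. z \<in> ZZ \<Longrightarrow> u \<in> Omega_closed L \<Longrightarrow> 0 \<le> lam z u"
    and lam_le: "\<And>z u. z \<in> ZZ \<Longrightarrow> u \<in> Omega_closed L \<Longrightarrow> lam z u \<le> lmax"
    and lam_cont: "\<And>z. z \<in> ZZ \<Longrightarrow> continuous_on (Omega_closed L) (lam z)"
    and mass_bound: "\<And>i. AE \<omega> in M.
        emeasure (weighted_diagram_measure L w (Ds i \<omega>)) (Omega_closed L) \<le> ennreal Mw"
begin

abbreviation kerZ :: "'z \<Rightarrow> 'z \<Rightarrow> real" where "kerZ \<equiv> normalized_kernel ZZ KZ h"
abbreviation kerU :: "real \<times> real \<Rightarrow> real \<times> real \<Rightarrow> real" where "kerU \<equiv> normalized_kernel (Omega_closed L) KU k"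
abbreviation smooth :: "real \<times> real \<Rightarrow> diagram \<Rightarrow> real" where "smooth u a \<equiv> smoothed_diagram L w KU k a u"

definition mean_D :: "'z \<Rightarrow> real" where
  "mean_D z = expectation (\<lambda>\<omega>. kerZ z (Zs 0 \<omega>))"

definition mean_N :: "'z \<Rightarrow> real \<times> real \<Rightarrow> real" where
  "mean_N z u = expectation (\<lambda>\<omega>. kerZ z (Zs 0 \<omega>) * smooth u (Ds 0 \<omega>))"

text \<open>Bounds the terms of both averages, so that one exponent serves for the numerator and the
  denominator.\<close>

definition sup_bound :: real where
  "sup_bound = QZ * QU * Mw / (h ^ DIM('z) * k\<^sup>2)"

lemma sup_bound_pos: "0 < sup_bound"
  using const_bounds h k by (simp add: sup_bound_def)

lemma Zs_measurable [measurable]: "Zs i \<in> M \<rightarrow>\<^sub>M restrict_space borel ZZ"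
  and Ds_measurable [measurable]: "Ds i \<in> M \<rightarrow>\<^sub>M diagram_space L"
proof -
  have "(\<lambda>\<omega>. (Zs i \<omega>, Ds i \<omega>)) \<in> M \<rightarrow>\<^sub>M restrict_space borel ZZ \<Otimes>\<^sub>M diagram_space L"
    using indep unfolding indep_vars_def by auto
  from measurable_compose[OF this measurable_fst] measurable_compose[OF this measurable_snd]
  show "Zs i \<in> M \<rightarrow>\<^sub>M restrict_space borel ZZ" "Ds i \<in> M \<rightarrow>\<^sub>M diagram_space L" by simp_all
qed

lemma Zs_in_ZZ: "\<omega> \<in> space M \<Longrightarrow> Zs i \<omega> \<in> ZZ"
  using measurable_space[OF Zs_measurable] by (simp add: space_restrict_space)

lemma kerZ_nonneg: "0 \<le> kerZ z z'"
  by (rule normalized_kernel_nonneg[OF KZ h])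

lemma kerU_nonneg: "0 \<le> kerU u v"
  by (rule normalized_kernel_nonneg[OF KU k(1)])

lemma smooth_nonneg: "0 \<le> smooth u a"
  unfolding smoothed_diagram_def by (intro integral_nonneg_AE) (simp add: kerU_nonneg)

lemma kerZ_measurable_pair:
  "(\<lambda>p. kerZ (fst p) (snd p)) \<in> borel_measurable (restrict_space borel ZZ \<Otimes>\<^sub>M restrict_space borel ZZ)"
proof -
  have "continuous_on (ZZ \<times> ZZ) (\<lambda>p. kerZ (fst p) (snd p))"
    using massZ by (intro normalized_kernel_continuous KZ ZZ_compact h continuous_intros) force
  then have "(\<lambda>p. kerZ (fst p) (snd p)) \<in> borel_measurable (restrict_space borel (ZZ \<times> ZZ))"
    by (rule borel_measurable_continuous_on_restrict)
  moreover have "(\<lambda>p. (fst p, snd p)) \<in> restrict_space borel ZZ \<Otimes>\<^sub>M restrict_space borel ZZ \<rightarrow>\<^sub>M restrict_space borel (ZZ \<times> ZZ)"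
  proof (rule measurable_restrict_space2)
    have "fst \<in> restrict_space borel ZZ \<Otimes>\<^sub>M restrict_space borel ZZ \<rightarrow>\<^sub>M borel"
      "snd \<in> restrict_space borel ZZ \<Otimes>\<^sub>M restrict_space borel ZZ \<rightarrow>\<^sub>M borel"
      using measurable_fst[of "restrict_space borel ZZ" "restrict_space borel ZZ"]
        measurable_snd[of "restrict_space borel ZZ" "restrict_space borel ZZ"]
      by (auto simp: measurable_restrict_space2_iff)
    then show "(\<lambda>p. (fst p, snd p)) \<in> restrict_space borel ZZ \<Otimes>\<^sub>M restrict_space borel ZZ \<rightarrow>\<^sub>M borel"
      by (rule borel_measurable_Pair)
  qed (auto simp: space_pair_measure space_restrict_space)
  ultimately show ?thesis by (simp add: measurable_compose)
qed

lemma kerZ_measurable [measurable]: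
  assumes "f \<in> N \<rightarrow>\<^sub>M restrict_space borel ZZ" "g \<in> N \<rightarrow>\<^sub>M restrict_space borel ZZ"
  shows "(\<lambda>x. kerZ (f x) (g x)) \<in> borel_measurable N"
  using measurable_compose[OF measurable_Pair[OF assms] kerZ_measurable_pair] by simp

lemma kerU_measurable:
  assumes "u \<in> Omega_closed L"
  shows "kerU u \<in> borel_measurable (restrict_space borel (Omega_closed L))"
  using massU[OF assms]
  by (intro borel_measurable_continuous_on_restrict normalized_kernel_continuous KU Omega_closed_compact k
      continuous_intros) auto

lemma kerU_measurable_weighted:
  assumes "u \<in> Omega_closed L"
  shows "kerU u \<in> borel_measurable (weighted_diagram_measure L w a)"
  using kerU_measurable[OF assms] by (simp cong: measurable_cong_sets)

lemma smooth_eq: 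
  assumes "u \<in> Omega_closed L"
  shows "smooth u a = enn2real (\<integral>\<^sup>+v. ennreal (kerU u v) \<partial>weighted_diagram_measure L w a)"
  unfolding smoothed_diagram_def
  by (rule integral_eq_nn_integral[OF kerU_measurable_weighted[OF assms]]) (simp add: kerU_nonneg)

lemma smooth_measurable:
  assumes "u \<in> Omega_closed L"
  shows "smooth u \<in> borel_measurable (diagram_space L)"
proof -
  have "(\<lambda>v. ennreal (kerU u v)) \<in> borel_measurable (restrict_space borel (Omega_closed L))"
    using kerU_measurable[OF assms] by (rule measurable_compose[OF _ measurable_ennreal])
  from measurable_nn_integral_weighted_diagram_measure[OF w this]
  show ?thesis unfolding smooth_eq[OF assms] by (rule borel_measurable_enn2real)
qed

text \<open>
  Diagrams of finite weighted mass. For the others the Bochner integral defining \<open>smooth u a\<close> need not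
  agree with the nonnegative one.\<close>

context
  fixes a :: diagram
  assumes mass: "emeasure (weighted_diagram_measure L w a) (Omega_closed L) \<le> ennreal Mw"
begin

lemma finite_weighted_diagram_measure: "finite_measure (weighted_diagram_measure L w a)"
  using mass by (intro finite_measureI) (auto simp: top_unique)

lemma measure_weighted_diagram_measure_le: "measure (weighted_diagram_measure L w a) (Omega_closed L) \<le> Mw"
  using mass const_bounds by (simp add: measure_def enn2real_leI)

lemma kerU_integrable:
  assumes "u \<in> Omega_closed L"
  shows "integrable (weighted_diagram_measure L w a) (kerU u)"
proof -
  interpret W: finite_measure "weighted_diagram_measure L w a" by (rule finite_weighted_diagram_measure)
  show ?thesis
    using boundU[OF assms] kerU_nonneg
    by (intro W.integrable_const_bound[where B="QU / k\<^sup>2"] kerU_measurable_weighted assms) auto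
qed

lemma ennreal_smooth:
  assumes "u \<in> Omega_closed L"
  shows "ennreal (smooth u a) = (\<integral>\<^sup>+v. ennreal (kerU u v) \<partial>weighted_diagram_measure L w a)"
  unfolding smoothed_diagram_def
  by (rule nn_integral_eq_integral[OF kerU_integrable[OF assms], symmetric]) (simp add: kerU_nonneg)

lemma smooth_le:
  assumes "u \<in> Omega_closed L"
  shows "smooth u a \<le> QU * Mw / k\<^sup>2"
proof -
  interpret W: finite_measure "weighted_diagram_measure L w a" by (rule finite_weighted_diagram_measure)
  have "smooth u a \<le> (\<integral>v. QU / k\<^sup>2 \<partial>weighted_diagram_measure L w a)"
    unfolding smoothed_diagram_def
    by (intro integral_mono kerU_integrable assms boundU) auto
  also have "\<dots> = measure (weighted_diagram_measure L w a) (Omega_closed L) * (QU / k\<^sup>2)" by simp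
  also have "\<dots> \<le> Mw * (QU / k\<^sup>2)"
    using const_bounds k by (intro mult_right_mono measure_weighted_diagram_measure_le) auto
  finally show ?thesis by (simp add: mult.commute)
qed

lemma smooth_lipschitz:
  assumes "u \<in> Omega_closed L" "u' \<in> Omega_closed L"
  shows "\<bar>smooth u a - smooth u' a\<bar> \<le> QU * Mw / k ^ 5 * dist u u'"
proof -
  interpret W: finite_measure "weighted_diagram_measure L w a" by (rule finite_weighted_diagram_measure)
  let ?W = "weighted_diagram_measure L w a"
  have "smooth u a - smooth u' a = (\<integral>v. kerU u v - kerU u' v \<partial>?W)"
    unfolding smoothed_diagram_def
    by (rule Bochner_Integration.integral_diff[symmetric]) (intro kerU_integrable assms)+
  then have "\<bar>smooth u a - smooth u' a\<bar> \<le> (\<integral>v. \<bar>kerU u v - kerU u' v\<bar> \<partial>?W)"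
    using integral_abs_bound by metis
  also have "\<dots> \<le> (\<integral>v. QU / k ^ 5 * dist u u' \<partial>?W)"
    by (intro integral_mono lipU assms integrable_abs Bochner_Integration.integrable_diff kerU_integrable) auto
  also have "\<dots> = measure ?W (Omega_closed L) * (QU / k ^ 5 * dist u u')" by simp
  also have "\<dots> \<le> Mw * (QU / k ^ 5 * dist u u')"
    using const_bounds k by (intro mult_right_mono measure_weighted_diagram_measure_le) auto
  finally show ?thesis by (simp add: mult_ac)
qed

end

end

text \<open>All errors of the numerator and the denominator are measured in units of the denominator's mean
  \<open>d\<close>. Since \<open>D \<ge> d / 2 \<ge> \<rho>\<close>, the floor \<open>\<rho>\<close> is inactive and \<open>d\<close> cancels; truncating at \<open>B \<ge> l\<close> can only
  reduce the error. The primed quantities belong to the nearest point of a net.\<close>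

lemma ratio_error_le:
  fixes \<rho> :: real
  assumes d: "0 < d" "\<rho> \<le> d / 2" and t: "0 \<le> t" "t \<le> 1/2" and l: "0 \<le> l" "l \<le> B"
    and D: "\<bar>D - d\<bar> \<le> t * d" and N': "\<bar>N' - \<mu>\<bar> \<le> t * d" and NN': "\<bar>N - N'\<bar> \<le> t * d"
    and \<mu>: "\<bar>\<mu> - l' * d\<bar> \<le> s * d" and l': "\<bar>l' - l\<bar> \<le> s"
  shows "\<bar>min (N / max D \<rho>) B - l\<bar> \<le> 2 * (2 * t + t * B + 2 * s)"
proof -
  have td: "t * d \<le> 1/2 * d" using t d by (intro mult_right_mono) auto
  then have Dd: "d / 2 \<le> D" using D by linarith
  then have max: "max D \<rho> = D" and D0: "0 < D" using d by linarith+
  have "\<bar>l' * d - l * d\<bar> \<le> s * d"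
    using mult_right_mono[OF l', of d] d by (simp add: left_diff_distrib[symmetric] abs_mult)
  moreover have "\<bar>l * d - l * D\<bar> \<le> B * (t * d)"
  proof -
    have "\<bar>l * d - l * D\<bar> = l * \<bar>D - d\<bar>" using l by (simp add: right_diff_distrib[symmetric] abs_mult abs_minus_commute)
    also have "\<dots> \<le> B * (t * d)" using l D d t by (intro mult_mono) auto
    finally show ?thesis .
  qed
  ultimately have "\<bar>N - l * D\<bar> \<le> (2 * t + t * B + 2 * s) * d"
    using N' NN' \<mu> by (simp add: algebra_simps)
  moreover have "0 \<le> 2 * t + t * B + 2 * s" using t l l' by auto
  then have "(2 * t + t * B + 2 * s) * d \<le> (2 * t + t * B + 2 * s) * (2 * D)"
    using Dd by (intro mult_left_mono) auto
  ultimately have "\<bar>N - l * D\<bar> \<le> (2 * (2 * t + t * B + 2 * s)) * D" by (simp add: mult_ac)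
  moreover have "N / D - l = (N - l * D) / D" using D0 by (simp add: diff_divide_distrib)
  ultimately have "\<bar>N / D - l\<bar> \<le> 2 * (2 * t + t * B + 2 * s)"
    using D0 by (simp add: abs_divide pos_divide_le_eq)
  then show ?thesis unfolding max using l(2) by linarith
qed

context smoothed_sample
begin

abbreviation obs :: "('z \<times> diagram) measure" where
  "obs \<equiv> restrict_space borel ZZ \<Otimes>\<^sub>M diagram_space L"

lemma obs_measurable: "(\<lambda>\<omega>. (Zs i \<omega>, Ds i \<omega>)) \<in> M \<rightarrow>\<^sub>M obs"
  by measurable

lemma expectation_obs:
  fixes f :: "'z \<times> diagram \<Rightarrow> real"
  assumes f: "f \<in> borel_measurable obs"
  shows "expectation (\<lambda>\<omega>. f (Zs i \<omega>, Ds i \<omega>)) = expectation (\<lambda>\<omega>. f (Zs 0 \<omega>, Ds 0 \<omega>))"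
  using integral_distr[OF obs_measurable[of i] f] integral_distr[OF obs_measurable[of 0] f] ident[of i] by simp

lemma indep_obs:
  fixes f :: "'z \<times> diagram \<Rightarrow> real"
  assumes f: "f \<in> borel_measurable obs"
  shows "indep_vars (\<lambda>_. borel) (\<lambda>i \<omega>. f (Zs i \<omega>, Ds i \<omega>)) J"
  by (rule indep_vars_subset[OF indep_vars_compose2[OF indep f]]) auto

lemma D_term_measurable:
  assumes "z \<in> ZZ"
  shows "(\<lambda>p. kerZ z (fst p)) \<in> borel_measurable obs"
  by (rule kerZ_measurable) (use assms in \<open>auto simp: space_restrict_space\<close>)

lemma N_term_measurable:
  assumes "z \<in> ZZ" "u \<in> Omega_closed L"
  shows "(\<lambda>p. kerZ z (fst p) * smooth u (snd p)) \<in> borel_measurable obs"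
  by (intro borel_measurable_times D_term_measurable assms measurable_compose[OF measurable_snd smooth_measurable])

lemma D_term_le:
  assumes "z \<in> ZZ"
  shows "kerZ z z' \<le> sup_bound"
proof -
  have "1 * 1 \<le> QU * Mw" using const_bounds by (intro mult_mono) auto
  moreover have "k\<^sup>2 \<le> 1" using k by (simp add: power_le_one)
  ultimately have "1 \<le> QU * Mw / k\<^sup>2" using k by (simp add: pos_le_divide_eq)
  then have "QZ / h ^ DIM('z) * 1 \<le> QZ / h ^ DIM('z) * (QU * Mw / k\<^sup>2)"
    using const_bounds h by (intro mult_left_mono) auto
  then show ?thesis using boundZ[OF assms, of z'] by (simp add: sup_bound_def)
qed

lemma N_term_le:
  assumes "z \<in> ZZ" "u \<in> Omega_closed L"
  shows "AE \<omega> in M. 0 \<le> kerZ z (Zs i \<omega>) * smooth u (Ds i \<omega>) \<and> kerZ z (Zs i \<omega>) * smooth u (Ds i \<omega>) \<le> sup_bound"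
  using mass_bound[of i]
proof eventually_elim
  case (elim \<omega>)
  have "kerZ z (Zs i \<omega>) * smooth u (Ds i \<omega>) \<le> QZ / h ^ DIM('z) * (QU * Mw / k\<^sup>2)"
    using const_bounds h by (intro mult_mono boundZ smooth_le[OF elim] assms smooth_nonneg) auto
  then show ?case by (simp add: sup_bound_def kerZ_nonneg smooth_nonneg)
qed

lemma ennreal_mean_D:
  assumes z: "z \<in> ZZ"
  shows "ennreal (mean_D z) = (\<integral>\<^sup>+\<omega>. ennreal (kerZ z (Zs 0 \<omega>)) \<partial>M)"
proof -
  have "integrable M (\<lambda>\<omega>. kerZ z (Zs 0 \<omega>))"
  proof (rule integrable_const_bound[where B=sup_bound])
    show "AE \<omega> in M. norm (kerZ z (Zs 0 \<omega>)) \<le> sup_bound" by (simp add: kerZ_nonneg D_term_le[OF z])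
    show "(\<lambda>\<omega>. kerZ z (Zs 0 \<omega>)) \<in> borel_measurable M"
      using measurable_compose[OF obs_measurable D_term_measurable[OF z]] by simp
  qed
  then show ?thesis
    unfolding mean_D_def by (intro nn_integral_eq_integral[symmetric]) (auto simp: kerZ_nonneg)
qed

text \<open>Conditioning on the covariate replaces the smoothed diagram by the smoothed conditional intensity.\<close>

lemma nn_integral_N_term:
  assumes z: "z \<in> ZZ" and u: "u \<in> Omega_closed L"
  shows "ennreal (mean_N z u) = (\<integral>\<^sup>+\<omega>. ennreal (kerZ z (Zs 0 \<omega>)) * (\<integral>\<^sup>+v. ennreal (kerU u v) \<partial>\<Lambda> (Zs 0 \<omega>)) \<partial>M)"
proof -
  have "integrable M (\<lambda>\<omega>. kerZ z (Zs 0 \<omega>) * smooth u (Ds 0 \<omega>))"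
  proof (rule integrable_const_bound[where B=sup_bound])
    show "AE \<omega> in M. norm (kerZ z (Zs 0 \<omega>) * smooth u (Ds 0 \<omega>)) \<le> sup_bound"
      using N_term_le[OF z u, of 0] by eventually_elim auto
    show "(\<lambda>\<omega>. kerZ z (Zs 0 \<omega>) * smooth u (Ds 0 \<omega>)) \<in> borel_measurable M"
      using measurable_compose[OF obs_measurable N_term_measurable[OF z u]] by simp
  qed
  then have "ennreal (mean_N z u) = (\<integral>\<^sup>+\<omega>. ennreal (kerZ z (Zs 0 \<omega>) * smooth u (Ds 0 \<omega>)) \<partial>M)"
    unfolding mean_N_def
    by (intro nn_integral_eq_integral[symmetric]) (auto simp: kerZ_nonneg smooth_nonneg)
  also have "\<dots> = (\<integral>\<^sup>+\<omega>. ennreal (kerZ z (Zs 0 \<omega>)) *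
      (\<integral>\<^sup>+v. ennreal (kerU u v) \<partial>weighted_diagram_measure L w (Ds 0 \<omega>)) \<partial>M)"
    using mass_bound[of 0]
    by (intro nn_integral_cong_AE, eventually_elim)
      (simp add: ennreal_mult kerZ_nonneg smooth_nonneg ennreal_smooth[OF _ u])
  also have "\<dots> = (\<integral>\<^sup>+\<omega>. ennreal (kerZ z (Zs 0 \<omega>)) * (\<integral>\<^sup>+v. ennreal (kerU u v) \<partial>\<Lambda> (Zs 0 \<omega>)) \<partial>M)"
  proof (rule nn_integral_conditional_intensity[OF prob_space_axioms w \<Lambda> Zs_measurable Ds_measurable])
    show "(\<lambda>z'. ennreal (kerZ z z')) \<in> borel_measurable (restrict_space borel ZZ)"
      by (intro measurable_compose[OF _ measurable_ennreal] kerZ_measurable)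
        (use z in \<open>auto simp: space_restrict_space\<close>)
    show "(\<lambda>v. ennreal (kerU u v)) \<in> borel_measurable (restrict_space borel (Omega_closed L))"
      by (rule measurable_compose[OF kerU_measurable[OF u] measurable_ennreal])
  qed
  finally show ?thesis .
qed

lemma nn_integral_kerU_intensity:
  assumes z: "z \<in> ZZ" and u: "u \<in> Omega_closed L"
  shows "(\<integral>\<^sup>+v. ennreal (kerU u v) \<partial>\<Lambda> z)
       = (\<integral>\<^sup>+v. ennreal (lam z v) * ennreal (kerU u v) \<partial>restrict_space lborel (Omega_closed L))"
proof -
  have s: "sets (restrict_space lborel (Omega_closed L)) = sets (restrict_space borel (Omega_closed L))"
    by (simp add: sets_restrict_space)
  have "(\<lambda>v. ennreal (lam z v)) \<in> borel_measurable (restrict_space lborel (Omega_closed L))"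
    unfolding measurable_cong_sets[OF s refl]
    by (rule measurable_compose[OF borel_measurable_continuous_on_restrict[OF lam_cont[OF z]] measurable_ennreal])
  moreover have "(\<lambda>v. ennreal (kerU u v)) \<in> borel_measurable (restrict_space lborel (Omega_closed L))"
    unfolding measurable_cong_sets[OF s refl]
    by (rule measurable_compose[OF kerU_measurable[OF u] measurable_ennreal])
  ultimately show ?thesis unfolding \<Lambda>_density[OF z] by (rule nn_integral_density)
qed

lemma nn_integral_const_kerU:
  assumes u: "u \<in> Omega_closed L"
  shows "(\<integral>\<^sup>+v. ennreal b * ennreal (kerU u v) \<partial>restrict_space lborel (Omega_closed L)) = ennreal b"
proof -
  have s: "sets (restrict_space lborel (Omega_closed L)) = sets (restrict_space borel (Omega_closed L))"
    by (simp add: sets_restrict_space)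
  have "(\<lambda>v. ennreal (kerU u v)) \<in> borel_measurable (restrict_space lborel (Omega_closed L))"
    unfolding measurable_cong_sets[OF s refl]
    by (rule measurable_compose[OF kerU_measurable[OF u] measurable_ennreal])
  then show ?thesis
    by (simp add: nn_integral_cmult nn_integral_normalized_kernel[OF KU Omega_closed_compact k(1) massU[OF u]])
qed

lemma mean_D_nonneg: "0 \<le> mean_D z"
  unfolding mean_D_def by (intro integral_nonneg_AE) (simp add: kerZ_nonneg)

lemma mean_N_nonneg: "0 \<le> mean_N z u"
  unfolding mean_N_def by (intro integral_nonneg_AE) (simp add: kerZ_nonneg smooth_nonneg)

lemma nn_integral_const_kerZ:
  assumes "z \<in> ZZ" "0 \<le> b"
  shows "(\<integral>\<^sup>+\<omega>. ennreal (kerZ z (Zs 0 \<omega>)) * ennreal b \<partial>M) = ennreal (b * mean_D z)"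
proof -
  have "(\<lambda>\<omega>. ennreal (kerZ z (Zs 0 \<omega>))) \<in> borel_measurable M"
    using measurable_compose[OF obs_measurable D_term_measurable[OF assms(1)]]
    by (intro measurable_compose[OF _ measurable_ennreal]) simp
  then have "(\<integral>\<^sup>+\<omega>. ennreal (kerZ z (Zs 0 \<omega>)) * ennreal b \<partial>M)
      = (\<integral>\<^sup>+\<omega>. ennreal (kerZ z (Zs 0 \<omega>)) \<partial>M) * ennreal b"
    by (rule nn_integral_multc)
  also have "\<dots> = ennreal (b * mean_D z)"
    unfolding ennreal_mean_D[OF assms(1), symmetric]
    using assms mean_D_nonneg by (simp add: ennreal_mult mult.commute)
  finally show ?thesis .
qed

text \<open>Since \<open>kerU u\<close> integrates to one over the triangle, \<open>mean_N z u\<close> is \<open>mean_D z\<close> times an average of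
  \<open>lam\<close> over the supports of the two kernels. The bias is thus bounded by the oscillation of \<open>lam\<close>,
  relative to \<open>mean_D z\<close>.\<close>

lemma mean_N_le:
  assumes z: "z \<in> ZZ" and u: "u \<in> Omega_closed L" and b: "0 \<le> b"
    and loc: "\<And>z' v. z' \<in> ZZ \<Longrightarrow> v \<in> Omega_closed L \<Longrightarrow> dist z z' \<le> h \<Longrightarrow> dist u v \<le> k \<Longrightarrow> lam z' v \<le> b"
  shows "mean_N z u \<le> b * mean_D z"
proof -
  have "ennreal (mean_N z u) \<le> (\<integral>\<^sup>+\<omega>. ennreal (kerZ z (Zs 0 \<omega>)) * ennreal b \<partial>M)"
    unfolding nn_integral_N_term[OF z u]
  proof (intro nn_integral_mono)
    fix \<omega> assume "\<omega> \<in> space M"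
    then have Z0: "Zs 0 \<omega> \<in> ZZ" by (rule Zs_in_ZZ)
    show "ennreal (kerZ z (Zs 0 \<omega>)) * (\<integral>\<^sup>+v. ennreal (kerU u v) \<partial>\<Lambda> (Zs 0 \<omega>)) \<le> ennreal (kerZ z (Zs 0 \<omega>)) * ennreal b"
    proof (cases "kerZ z (Zs 0 \<omega>) = 0")
      case False
      then have near: "dist z (Zs 0 \<omega>) \<le> h" by (rule normalized_kernel_support[OF KZ h])
      have "(\<integral>\<^sup>+v. ennreal (kerU u v) \<partial>\<Lambda> (Zs 0 \<omega>))
          \<le> (\<integral>\<^sup>+v. ennreal b * ennreal (kerU u v) \<partial>restrict_space lborel (Omega_closed L))"
        unfolding nn_integral_kerU_intensity[OF Z0 u]
      proof (intro nn_integral_mono)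
        fix v assume v: "v \<in> space (restrict_space lborel (Omega_closed L))"
        then have v: "v \<in> Omega_closed L" by (simp add: space_restrict_space)
        show "ennreal (lam (Zs 0 \<omega>) v) * ennreal (kerU u v) \<le> ennreal b * ennreal (kerU u v)"
        proof (cases "kerU u v = 0")
          case False
          then have "dist u v \<le> k" by (rule normalized_kernel_support[OF KU k(1)])
          then show ?thesis by (intro mult_right_mono ennreal_leI loc Z0 v near) auto
        qed auto
      qed
      then show ?thesis unfolding nn_integral_const_kerU[OF u] by (intro mult_left_mono) auto
    qed auto
  qed
  then show ?thesis
    unfolding nn_integral_const_kerZ[OF z b] using b mean_D_nonneg by (simp add: ennreal_le_iff)
qed

lemma mean_N_ge:
  assumes z: "z \<in> ZZ" and u: "u \<in> Omega_closed L"
    and loc: "\<And>z' v. z' \<in> ZZ \<Longrightarrow> v \<in> Omega_closed L \<Longrightarrow> dist z z' \<le> h \<Longrightarrow> dist u v \<le> k \<Longrightarrow> b \<le> lam z' v"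
  shows "b * mean_D z \<le> mean_N z u"
proof (cases "0 \<le> b")
  case False
  then have "b * mean_D z \<le> 0" using mean_D_nonneg[of z] by (simp add: mult_nonpos_nonneg)
  then show ?thesis using mean_N_nonneg[of z u] by linarith
next
  case b: True
  have "(\<integral>\<^sup>+\<omega>. ennreal (kerZ z (Zs 0 \<omega>)) * ennreal b \<partial>M) \<le> ennreal (mean_N z u)"
    unfolding nn_integral_N_term[OF z u]
  proof (intro nn_integral_mono)
    fix \<omega> assume "\<omega> \<in> space M"
    then have Z0: "Zs 0 \<omega> \<in> ZZ" by (rule Zs_in_ZZ)
    show "ennreal (kerZ z (Zs 0 \<omega>)) * ennreal b \<le> ennreal (kerZ z (Zs 0 \<omega>)) * (\<integral>\<^sup>+v. ennreal (kerU u v) \<partial>\<Lambda> (Zs 0 \<omega>))"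
    proof (cases "kerZ z (Zs 0 \<omega>) = 0")
      case False
      then have near: "dist z (Zs 0 \<omega>) \<le> h" by (rule normalized_kernel_support[OF KZ h])
      have "(\<integral>\<^sup>+v. ennreal b * ennreal (kerU u v) \<partial>restrict_space lborel (Omega_closed L))
          \<le> (\<integral>\<^sup>+v. ennreal (kerU u v) \<partial>\<Lambda> (Zs 0 \<omega>))"
        unfolding nn_integral_kerU_intensity[OF Z0 u]
      proof (intro nn_integral_mono)
        fix v assume v: "v \<in> space (restrict_space lborel (Omega_closed L))"
        then have v: "v \<in> Omega_closed L" by (simp add: space_restrict_space)
        show "ennreal b * ennreal (kerU u v) \<le> ennreal (lam (Zs 0 \<omega>) v) * ennreal (kerU u v)"
        proof (cases "kerU u v = 0")
          case False
          then have "dist u v \<le> k" by (rule normalized_kernel_support[OF KU k(1)])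
          then show ?thesis by (intro mult_right_mono ennreal_leI loc Z0 v near) auto
        qed auto
      qed
      then show ?thesis unfolding nn_integral_const_kerU[OF u] by (intro mult_left_mono) auto
    qed auto
  qed
  then show ?thesis
    unfolding nn_integral_const_kerZ[OF z b] using mean_N_nonneg by (simp add: ennreal_le_iff)
qed

abbreviation hat_D :: "nat \<Rightarrow> 'z \<Rightarrow> 'a \<Rightarrow> real" where
  "hat_D n z \<omega> \<equiv> D_hat ZZ KZ h n (\<lambda>i. Zs i \<omega>) z"

abbreviation hat_N :: "nat \<Rightarrow> 'z \<Rightarrow> real \<times> real \<Rightarrow> 'a \<Rightarrow> real" where
  "hat_N n z u \<omega> \<equiv> N_hat ZZ L w KZ KU h k n (\<lambda>i. Zs i \<omega>) (\<lambda>i. Ds i \<omega>) z u"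

definition tail :: "nat \<Rightarrow> real \<Rightarrow> 'z \<Rightarrow> real" where
  "tail n t z = 2 * exp (- (t\<^sup>2 / (4 * lmax)) * (real n * mean_D z / sup_bound))"

lemma prob_hat_D_deviation:
  assumes z: "z \<in> ZZ" and n: "0 < n" and d: "0 < mean_D z" and t: "0 < t" "t \<le> 1"
  shows "prob {\<omega> \<in> space M. t * mean_D z < \<bar>hat_D n z \<omega> - mean_D z\<bar>} \<le> tail n t z"
  unfolding D_hat_def tail_def
proof (rule relative_deviation_bound[OF _ sup_bound_pos n])
  show "indep_vars (\<lambda>_. borel) (\<lambda>i \<omega>. kerZ z (Zs i \<omega>)) {..<n}"
    using indep_obs[OF D_term_measurable[OF z]] by simp
  show "AE \<omega> in M. 0 \<le> kerZ z (Zs i \<omega>) \<and> kerZ z (Zs i \<omega>) \<le> sup_bound" for i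
    by (simp add: kerZ_nonneg D_term_le[OF z])
  show "expectation (\<lambda>\<omega>. kerZ z (Zs i \<omega>)) = mean_D z" for i
    using expectation_obs[OF D_term_measurable[OF z], of i] by (simp add: mean_D_def)
qed (use d t const_bounds in auto)

lemma prob_hat_N_deviation:
  assumes z: "z \<in> ZZ" and u: "u \<in> Omega_closed L" and n: "0 < n" and d: "0 < mean_D z" and t: "0 < t" "t \<le> 1"
  shows "prob {\<omega> \<in> space M. t * mean_D z < \<bar>hat_N n z u \<omega> - mean_N z u\<bar>} \<le> tail n t z"
  unfolding N_hat_def tail_def
proof (rule relative_deviation_bound[OF _ sup_bound_pos n])
  show "indep_vars (\<lambda>_. borel) (\<lambda>i \<omega>. kerZ z (Zs i \<omega>) * smooth u (Ds i \<omega>)) {..<n}"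
    using indep_obs[OF N_term_measurable[OF z u]] by simp
  show "AE \<omega> in M. 0 \<le> kerZ z (Zs i \<omega>) * smooth u (Ds i \<omega>) \<and> kerZ z (Zs i \<omega>) * smooth u (Ds i \<omega>) \<le> sup_bound" for i
    by (rule N_term_le[OF z u])
  show "expectation (\<lambda>\<omega>. kerZ z (Zs i \<omega>) * smooth u (Ds i \<omega>)) = mean_N z u" for i
    using expectation_obs[OF N_term_measurable[OF z u], of i] by (simp add: mean_N_def)
  show "mean_N z u \<le> lmax * mean_D z"
    using const_bounds by (intro mean_N_le z u lam_le) auto
qed (use d t const_bounds in auto)

lemma hat_D_measurable:
  "(\<lambda>p. hat_D n (fst p) (snd p)) \<in> borel_measurable (restrict_space borel ZZ \<Otimes>\<^sub>M M)"
  unfolding D_hat_def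
  by (intro borel_measurable_times borel_measurable_const borel_measurable_sum kerZ_measurable
      measurable_fst measurable_compose[OF measurable_snd Zs_measurable])

lemma hat_N_measurable:
  assumes u: "u \<in> Omega_closed L"
  shows "(\<lambda>p. hat_N n (fst p) u (snd p)) \<in> borel_measurable (restrict_space borel ZZ \<Otimes>\<^sub>M M)"
  unfolding N_hat_def
  by (intro borel_measurable_times borel_measurable_const borel_measurable_sum kerZ_measurable
      measurable_fst measurable_compose[OF measurable_snd Zs_measurable]
      measurable_compose[OF measurable_compose[OF measurable_snd Ds_measurable] smooth_measurable[OF u]])

lemma mean_D_measurable: "mean_D \<in> borel_measurable (restrict_space borel ZZ)"
proof -
  have "(\<lambda>p. kerZ (fst p) (Zs 0 (snd p))) \<in> borel_measurable (restrict_space borel ZZ \<Otimes>\<^sub>M M)"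
    by (intro kerZ_measurable measurable_fst measurable_compose[OF measurable_snd Zs_measurable])
  then have "case_prod (\<lambda>z \<omega>. kerZ z (Zs 0 \<omega>)) \<in> borel_measurable (restrict_space borel ZZ \<Otimes>\<^sub>M M)"
    by (simp add: case_prod_beta')
  then show ?thesis unfolding mean_D_def[abs_def] by (rule borel_measurable_lebesgue_integral)
qed

lemma mean_N_measurable:
  assumes u: "u \<in> Omega_closed L"
  shows "(\<lambda>z. mean_N z u) \<in> borel_measurable (restrict_space borel ZZ)"
proof -
  have "(\<lambda>p. kerZ (fst p) (Zs 0 (snd p)) * smooth u (Ds 0 (snd p))) \<in> borel_measurable (restrict_space borel ZZ \<Otimes>\<^sub>M M)"
    by (intro borel_measurable_times kerZ_measurable measurable_fst measurable_compose[OF measurable_snd Zs_measurable]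
      measurable_compose[OF measurable_compose[OF measurable_snd Ds_measurable] smooth_measurable[OF u]])
  then have "case_prod (\<lambda>z \<omega>. kerZ z (Zs 0 \<omega>) * smooth u (Ds 0 \<omega>)) \<in> borel_measurable (restrict_space borel ZZ \<Otimes>\<^sub>M M)"
    by (simp add: case_prod_beta')
  then show ?thesis unfolding mean_N_def[abs_def] by (rule borel_measurable_lebesgue_integral)
qed

text \<open>The points \<open>u\<close> range over a finite net \<open>F\<close> of the triangle rather than over the whole of it, which
  keeps the set measurable and makes a union bound possible.\<close>

definition deviant :: "nat \<Rightarrow> real \<Rightarrow> (real \<times> real) set \<Rightarrow> ('z \<times> 'a) set" where
  "deviant n t F = {(z, \<omega>). z \<in> ZZ \<and> \<omega> \<in> space M \<and>
     (t * mean_D z < \<bar>hat_D n z \<omega> - mean_D z\<bar> \<or> (\<exists>u\<in>F. t * mean_D z < \<bar>hat_N n z u \<omega> - mean_N z u\<bar>))}"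

lemma sets_deviant:
  assumes F: "finite F" "F \<subseteq> Omega_closed L"
  shows "deviant n t F \<in> sets (restrict_space borel ZZ \<Otimes>\<^sub>M M)"
proof -
  let ?P = "restrict_space borel ZZ \<Otimes>\<^sub>M M"
  have [measurable]: "(\<lambda>p. mean_D (fst p)) \<in> borel_measurable ?P"
    by (rule measurable_compose[OF measurable_fst mean_D_measurable])
  note [measurable] = hat_D_measurable[of n]
  have D: "{p \<in> space ?P. t * mean_D (fst p) < \<bar>hat_D n (fst p) (snd p) - mean_D (fst p)\<bar>} \<in> sets ?P"
    by measurable
  have N: "{p \<in> space ?P. t * mean_D (fst p) < \<bar>hat_N n (fst p) u (snd p) - mean_N (fst p) u\<bar>} \<in> sets ?P"
    if "u \<in> F" for u
  proof -
    have u: "u \<in> Omega_closed L" using that F by auto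
    note [measurable] = hat_N_measurable[OF u, of n] measurable_compose[OF measurable_fst mean_N_measurable[OF u]]
    show ?thesis by measurable
  qed
  have "deviant n t F = {p \<in> space ?P. t * mean_D (fst p) < \<bar>hat_D n (fst p) (snd p) - mean_D (fst p)\<bar>}
      \<union> (\<Union>u\<in>F. {p \<in> space ?P. t * mean_D (fst p) < \<bar>hat_N n (fst p) u (snd p) - mean_N (fst p) u\<bar>})"
    by (auto simp: deviant_def space_pair_measure space_restrict_space)
  then show ?thesis using D N F(1) by (auto intro!: sets.Un sets.finite_UN)
qed

lemma prob_deviant_le:
  assumes z: "z \<in> ZZ" and F: "finite F" "F \<subseteq> Omega_closed L"
    and n: "0 < n" and d: "0 < mean_D z" and t: "0 < t" "t \<le> 1"
  shows "prob {\<omega> \<in> space M. (z, \<omega>) \<in> deviant n t F} \<le> (real (card F) + 1) * tail n t z"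
proof -
  let ?D = "{\<omega> \<in> space M. t * mean_D z < \<bar>hat_D n z \<omega> - mean_D z\<bar>}"
  let ?N = "\<lambda>u. {\<omega> \<in> space M. t * mean_D z < \<bar>hat_N n z u \<omega> - mean_N z u\<bar>}"
  have sec: "(\<lambda>\<omega>. (z, \<omega>)) \<in> M \<rightarrow>\<^sub>M restrict_space borel ZZ \<Otimes>\<^sub>M M"
    by (rule measurable_Pair1') (use z in \<open>simp add: space_restrict_space\<close>)
  have "(\<lambda>\<omega>. hat_D n z \<omega>) \<in> borel_measurable M"
    using measurable_compose[OF sec hat_D_measurable[of n]] by simp
  then have D: "?D \<in> events" by measurable
  have N: "?N u \<in> events" if "u \<in> F" for u
  proof -
    have "(\<lambda>\<omega>. hat_N n z u \<omega>) \<in> borel_measurable M"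
      using measurable_compose[OF sec hat_N_measurable[of u n]] that F by auto
    then show ?thesis by measurable
  qed
  have "prob {\<omega> \<in> space M. (z, \<omega>) \<in> deviant n t F} \<le> prob (?D \<union> (\<Union>u\<in>F. ?N u))"
    using D N F by (intro finite_measure_mono) (auto simp: deviant_def intro!: sets.Un sets.finite_UN)
  also have "\<dots> \<le> prob ?D + prob (\<Union>u\<in>F. ?N u)"
    using D N F by (intro measure_Un_le) (auto intro!: sets.finite_UN)
  also have "prob (\<Union>u\<in>F. ?N u) \<le> (\<Sum>u\<in>F. prob (?N u))"
    using N F by (intro measure_UNION_le) auto
  also have "\<dots> \<le> (\<Sum>u\<in>F. tail n t z)"
    using F by (intro sum_mono prob_hat_N_deviation z n d t) auto
  also have "prob ?D + (\<Sum>u\<in>F. tail n t z) \<le> (real (card F) + 1) * tail n t z"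
    using prob_hat_D_deviation[OF z n d t] by (simp add: distrib_right)
  finally show ?thesis by simp
qed

lemma hat_D_nonneg: "0 \<le> hat_D n z \<omega>"
  unfolding D_hat_def by (intro mult_nonneg_nonneg sum_nonneg) (auto simp: kerZ_nonneg)

lemma hat_N_nonneg: "0 \<le> hat_N n z u \<omega>"
  unfolding N_hat_def by (intro mult_nonneg_nonneg sum_nonneg) (auto simp: kerZ_nonneg smooth_nonneg)

lemma expectation_hat_D:
  assumes z: "z \<in> ZZ" and n: "0 < n"
  shows "expectation (hat_D n z) = mean_D z"
proof -
  have "integrable M (\<lambda>\<omega>. kerZ z (Zs i \<omega>))" for i
  proof (rule integrable_const_bound[where B=sup_bound])
    show "AE \<omega> in M. norm (kerZ z (Zs i \<omega>)) \<le> sup_bound" by (simp add: kerZ_nonneg D_term_le[OF z])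
    show "(\<lambda>\<omega>. kerZ z (Zs i \<omega>)) \<in> borel_measurable M"
      using measurable_compose[OF obs_measurable D_term_measurable[OF z]] by simp
  qed
  then have "expectation (hat_D n z) = 1 / real n * (\<Sum>i<n. expectation (\<lambda>\<omega>. kerZ z (Zs i \<omega>)))"
    unfolding D_hat_def by simp
  also have "(\<Sum>i<n. expectation (\<lambda>\<omega>. kerZ z (Zs i \<omega>))) = (\<Sum>i<n. mean_D z)"
    using expectation_obs[OF D_term_measurable[OF z]] unfolding mean_D_def fst_conv by (intro sum.cong refl)
  finally show ?thesis using n by simp
qed

text \<open>The factor \<open>hat_D n z \<omega>\<close> makes the error of passing to a net relative to the denominator too.\<close>

lemma hat_N_lipschitz:
  assumes mass: "\<And>i. emeasure (weighted_diagram_measure L w (Ds i \<omega>)) (Omega_closed L) \<le> ennreal Mw"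
    and u: "u \<in> Omega_closed L" "u' \<in> Omega_closed L"
  shows "\<bar>hat_N n z u \<omega> - hat_N n z u' \<omega>\<bar> \<le> QU * Mw / k ^ 5 * dist u u' * hat_D n z \<omega>"
proof -
  let ?c = "QU * Mw / k ^ 5 * dist u u'"
  have "hat_N n z u \<omega> - hat_N n z u' \<omega>
      = 1 / real n * (\<Sum>i<n. kerZ z (Zs i \<omega>) * (smooth u (Ds i \<omega>) - smooth u' (Ds i \<omega>)))"
    unfolding N_hat_def by (simp add: right_diff_distrib sum_subtractf)
  then have "\<bar>hat_N n z u \<omega> - hat_N n z u' \<omega>\<bar>
      = 1 / real n * \<bar>\<Sum>i<n. kerZ z (Zs i \<omega>) * (smooth u (Ds i \<omega>) - smooth u' (Ds i \<omega>))\<bar>"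
    by (simp add: abs_mult)
  also have "\<dots> \<le> 1 / real n * (\<Sum>i<n. \<bar>kerZ z (Zs i \<omega>) * (smooth u (Ds i \<omega>) - smooth u' (Ds i \<omega>))\<bar>)"
    by (intro mult_left_mono sum_abs) auto
  also have "\<dots> \<le> 1 / real n * (\<Sum>i<n. kerZ z (Zs i \<omega>) * ?c)"
  proof (intro mult_left_mono sum_mono)
    fix i
    show "\<bar>kerZ z (Zs i \<omega>) * (smooth u (Ds i \<omega>) - smooth u' (Ds i \<omega>))\<bar> \<le> kerZ z (Zs i \<omega>) * ?c"
      unfolding abs_mult abs_of_nonneg[OF kerZ_nonneg]
      by (rule mult_left_mono[OF smooth_lipschitz[OF mass u] kerZ_nonneg])
  qed simp
  also have "\<dots> = ?c * hat_D n z \<omega>"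
    unfolding D_hat_def sum_distrib_right[symmetric] by (simp only: mult_ac)
  finally show ?thesis .
qed

lemma estimator_bounded:
  assumes "z \<in> ZZ" "u \<in> Omega_closed L" "0 < \<rho>" "lam z u \<le> B"
  shows "\<bar>lambda_hat ZZ L w KZ KU h k \<rho> B n (\<lambda>i. Zs i \<omega>) (\<lambda>i. Ds i \<omega>) z u - lam z u\<bar> \<le> B"
proof -
  have "0 \<le> hat_N n z u \<omega> / max (hat_D n z \<omega>) \<rho>"
    using assms(3) hat_N_nonneg by (intro divide_nonneg_nonneg) auto
  then show ?thesis using lam_nonneg[OF assms(1,2)] assms(4) unfolding lambda_hat_def by linarith
qed

lemma estimator_error:
  assumes mass: "\<And>i. emeasure (weighted_diagram_measure L w (Ds i \<omega>)) (Omega_closed L) \<le> ennreal Mw"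
    and z: "z \<in> ZZ" and \<omega>: "\<omega> \<in> space M" "(z, \<omega>) \<notin> deviant n t F"
    and u: "u \<in> Omega_closed L" and v: "v \<in> F" "v \<in> Omega_closed L"
    and uv: "dist u v \<le> k" "QU * Mw / k ^ 5 * dist u v \<le> t / 2"
    and osc: "\<And>x z' y. x \<in> Omega_closed L \<Longrightarrow> z' \<in> ZZ \<Longrightarrow> y \<in> Omega_closed L \<Longrightarrow> dist z z' \<le> h \<Longrightarrow> dist x y \<le> k \<Longrightarrow>
       \<bar>lam z' y - lam z x\<bar> \<le> s"
    and t: "0 < t" "t \<le> 1/2" and d: "0 < mean_D z" "\<rho> \<le> mean_D z / 2" and B: "lam z u \<le> B"
  shows "\<bar>lambda_hat ZZ L w KZ KU h k \<rho> B n (\<lambda>i. Zs i \<omega>) (\<lambda>i. Ds i \<omega>) z u - lam z u\<bar> \<le> 2 * (2 * t + t * B + 2 * s)"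
  unfolding lambda_hat_def
proof (rule ratio_error_le[OF d])
  show "0 \<le> t" "t \<le> 1/2" using t by auto
  show "0 \<le> lam z u" "lam z u \<le> B" using lam_nonneg[OF z u] B by auto
  show D: "\<bar>hat_D n z \<omega> - mean_D z\<bar> \<le> t * mean_D z"
    and "\<bar>hat_N n z v \<omega> - mean_N z v\<bar> \<le> t * mean_D z"
    using \<omega> z v by (auto simp: deviant_def not_less)
  show "\<bar>lam z v - lam z u\<bar> \<le> s" using osc[OF u z v(2) _ uv(1)] h by simp
  have s0: "0 \<le> s" using osc[OF u z u] h k by simp
  have "mean_N z v \<le> (lam z v + s) * mean_D z"
  proof (intro mean_N_le z v)
    show "0 \<le> lam z v + s" using lam_nonneg[OF z v(2)] s0 by simp
    fix z' y assume "z' \<in> ZZ" "y \<in> Omega_closed L" "dist z z' \<le> h" "dist v y \<le> k"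
    then show "lam z' y \<le> lam z v + s" using osc[OF v(2)] by fastforce
  qed
  moreover have "(lam z v - s) * mean_D z \<le> mean_N z v"
  proof (intro mean_N_ge z v)
    fix z' y assume "z' \<in> ZZ" "y \<in> Omega_closed L" "dist z z' \<le> h" "dist v y \<le> k"
    then show "lam z v - s \<le> lam z' y" using osc[OF v(2)] by fastforce
  qed
  ultimately show "\<bar>mean_N z v - lam z v * mean_D z\<bar> \<le> s * mean_D z"
    by (simp add: algebra_simps abs_le_iff)
  have "\<bar>hat_N n z u \<omega> - hat_N n z v \<omega>\<bar> \<le> QU * Mw / k ^ 5 * dist u v * hat_D n z \<omega>"
    by (rule hat_N_lipschitz[OF mass u v(2)])
  also have "\<dots> \<le> t / 2 * hat_D n z \<omega>" by (rule mult_right_mono[OF uv(2) hat_D_nonneg])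
  also have "\<dots> \<le> t / 2 * (2 * mean_D z)"
  proof (rule mult_left_mono)
    have "t * mean_D z \<le> 1 * mean_D z" using t d by (intro mult_right_mono) auto
    then show "hat_D n z \<omega> \<le> 2 * mean_D z" using D by linarith
  qed (use t in auto)
  finally show "\<bar>hat_N n z u \<omega> - hat_N n z v \<omega>\<bar> \<le> t * mean_D z" by simp
qed

text \<open>The net has mesh of order \<open>k ^ 5\<close>, the inverse of the Lipschitz constant of the smoothed diagrams;
  up to a constant, \<open>1 / k ^ 10\<close> bounds the number of its points.\<close>

lemma loss_exceeds_le:
  fixes P :: "'z measure"
  assumes P: "prob_space P" "sets P = sets (restrict_space borel ZZ)"
    and A: "A \<in> sets P" "measure P A > 1 - \<epsilon>" and d: "\<And>z. z \<in> A \<Longrightarrow> m \<le> mean_D z" "0 < m" and \<rho>: "0 < \<rho>" "\<rho> \<le> m / 2"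
    and n: "0 < n" and t: "0 < t" "t \<le> 1/2"
    and osc: "\<And>z x z' y. z \<in> ZZ \<Longrightarrow> x \<in> Omega_closed L \<Longrightarrow> z' \<in> ZZ \<Longrightarrow> y \<in> Omega_closed L \<Longrightarrow> dist z z' \<le> h \<Longrightarrow> dist x y \<le> k \<Longrightarrow>
       \<bar>lam z' y - lam z x\<bar> \<le> s"
    and B: "0 \<le> B" "\<And>z u. z \<in> ZZ \<Longrightarrow> u \<in> Omega_closed L \<Longrightarrow> lam z u \<le> B"
    and e: "0 < e" "0 \<le> s" "2 * (2 * t + t * B + 2 * s) + B * \<epsilon> \<le> e / 2"
  shows "outer_measure_of M {\<omega> \<in> space M. ennreal e < integrated_uniform_loss P L
           (lambda_hat ZZ L w KZ KU h k \<rho> B n (\<lambda>i. Zs i \<omega>) (\<lambda>i. Ds i \<omega>)) lam}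
       \<le> ennreal (2 * B * (((4 * L * QU * Mw / t + 1)\<^sup>2 / k ^ 10 + 1) *
           (2 * exp (- (t\<^sup>2 / (4 * lmax)) * (real n * m / sup_bound)))) / e)"
proof -
  (* 2 * r is at most k, and moves hat_N by at most t / 2 times hat_D *)
  define r where "r = t * k ^ 5 / (4 * (QU * Mw))"
  have QM: "1 \<le> QU * Mw" using const_bounds mult_mono[of 1 QU 1 Mw] by simp
  have r: "0 < r" using t k QM by (auto simp: r_def intro!: divide_pos_pos mult_pos_pos)
  obtain F where F: "finite F" "F \<subseteq> Omega_closed L" "real (card F) \<le> (L / r + 1)\<^sup>2"
    and net: "\<And>u. u \<in> Omega_closed L \<Longrightarrow> \<exists>v\<in>F. dist u v \<le> 2 * r"
    using Omega_closed_net[OF L_pos r] by blast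
  have card: "real (card F) \<le> (4 * L * QU * Mw / t + 1)\<^sup>2 / k ^ 10"
  proof -
    have "L / r + 1 \<le> (4 * L * QU * Mw / t + 1) / k ^ 5"
    proof -
      have "1 \<le> 1 / k ^ 5" using k by (simp add: power_le_one pos_le_divide_eq)
      moreover have "L / r = (4 * L * QU * Mw / t) / k ^ 5"
        using t k QM by (simp add: r_def field_simps)
      ultimately show ?thesis by (simp add: add_divide_distrib)
    qed
    then have "(L / r + 1)\<^sup>2 \<le> ((4 * L * QU * Mw / t + 1) / k ^ 5)\<^sup>2"
      using L_pos r by (intro power_mono) auto
    then show ?thesis using F(3) by (simp add: power_divide power_mult[symmetric])
  qed
  have AZ: "A \<subseteq> ZZ" using sets.sets_into_space[OF A(1)] sets_eq_imp_space_eq[OF P(2)]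
    by (simp add: space_restrict_space)
  have "AE \<omega> in M. \<forall>i. emeasure (weighted_diagram_measure L w (Ds i \<omega>)) (Omega_closed L) \<le> ennreal Mw"
    using mass_bound by (simp add: AE_all_countable)
  then obtain N where N: "N \<in> null_sets M"
    and mass: "\<And>\<omega> i. \<omega> \<in> space M \<Longrightarrow> \<omega> \<notin> N \<Longrightarrow>
      emeasure (weighted_diagram_measure L w (Ds i \<omega>)) (Omega_closed L) \<le> ennreal Mw"
    by (auto simp: eventually_ae_filter)
  (* outside the null set N every diagram of the sample has mass at most Mw *)
  define Bad where "Bad = deviant n t F \<union> ZZ \<times> N"
  define q where "q = ((4 * L * QU * Mw / t + 1)\<^sup>2 / k ^ 10 + 1) *
           (2 * exp (- (t\<^sup>2 / (4 * lmax)) * (real n * m / sup_bound)))"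
  show ?thesis
    unfolding integrated_uniform_loss_def q_def[symmetric]
  proof (rule outer_measure_loss_le[where Bad=Bad and A=A, OF prob_space_axioms P(1) _ A B(1) _ _ _ _ _ e(1,3)])
    have "ZZ \<in> sets (restrict_space borel ZZ)" using sets.top[of "restrict_space borel ZZ"] by (simp add: space_restrict_space)
    then have "Bad \<in> sets (restrict_space borel ZZ \<Otimes>\<^sub>M M)"
      unfolding Bad_def using N by (intro sets.Un sets_deviant F pair_measureI) auto
    then show "Bad \<in> sets (P \<Otimes>\<^sub>M M)" using sets_pair_measure_cong[OF P(2) refl, of M] by simp
    show "0 \<le> 2 * (2 * t + t * B + 2 * s)" using t B e by simp
    show "0 \<le> q" by (simp add: q_def)
    show "(SUP u\<in>Omega_closed L. ennreal \<bar>lambda_hat ZZ L w KZ KU h k \<rho> B n (\<lambda>i. Zs i \<omega>) (\<lambda>i. Ds i \<omega>) z u - lam z u\<bar>) \<le> ennreal B"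
      if "z \<in> space P" "\<omega> \<in> space M" for z \<omega>
    proof -
      have "z \<in> ZZ" using that sets_eq_imp_space_eq[OF P(2)] by (simp add: space_restrict_space)
      then show ?thesis by (intro SUP_least ennreal_leI estimator_bounded B \<rho>)
    qed
    show "(SUP u\<in>Omega_closed L. ennreal \<bar>lambda_hat ZZ L w KZ KU h k \<rho> B n (\<lambda>i. Zs i \<omega>) (\<lambda>i. Ds i \<omega>) z u - lam z u\<bar>)
        \<le> ennreal (2 * (2 * t + t * B + 2 * s))"
      if zA: "z \<in> A" and \<omega>: "\<omega> \<in> space M" "(z, \<omega>) \<notin> Bad" for z \<omega>
    proof (intro SUP_least ennreal_leI)
      fix u assume u: "u \<in> Omega_closed L"
      have z: "z \<in> ZZ" using zA AZ by auto
      obtain v where v: "v \<in> F" "dist u v \<le> 2 * r" using net[OF u] by blast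
      have "t * k ^ 5 \<le> 1 * (k * 1)"
      proof (intro mult_mono)
        have "k ^ 5 = k * k ^ 4" by (simp add: numeral_eq_Suc)
        also have "\<dots> \<le> k * 1" using k by (intro mult_left_mono power_le_one) auto
        finally show "k ^ 5 \<le> k * 1" .
      qed (use t k in auto)
      also have "\<dots> \<le> k * (2 * (QU * Mw))" using QM k by simp
      finally have "2 * r \<le> k" using QM by (simp add: r_def pos_divide_le_eq mult_ac)
      then have uv: "dist u v \<le> k" using v by linarith
      have "QU * Mw / k ^ 5 * dist u v \<le> QU * Mw / k ^ 5 * (2 * r)"
        using v QM k by (intro mult_left_mono) auto
      also have "\<dots> = t / 2" using const_bounds k by (simp add: r_def field_simps)
      finally have uv2: "QU * Mw / k ^ 5 * dist u v \<le> t / 2" .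
      show "\<bar>lambda_hat ZZ L w KZ KU h k \<rho> B n (\<lambda>i. Zs i \<omega>) (\<lambda>i. Ds i \<omega>) z u - lam z u\<bar> \<le> 2 * (2 * t + t * B + 2 * s)"
      proof (rule estimator_error[OF _ z \<omega>(1) _ u v(1) _ uv uv2 osc[OF z] t])
        show "emeasure (weighted_diagram_measure L w (Ds i \<omega>)) (Omega_closed L) \<le> ennreal Mw" for i
          using mass[OF \<omega>(1)] \<omega>(2) z by (auto simp: Bad_def)
        show "(z, \<omega>) \<notin> deviant n t F" using \<omega> by (auto simp: Bad_def)
        show "v \<in> Omega_closed L" using v F by auto
        show "0 < mean_D z" "\<rho> \<le> mean_D z / 2" using d(1)[OF zA] d(2) \<rho> by auto
        show "lam z u \<le> B" by (rule B(2)[OF z u])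
      qed
    qed
    show "prob {\<omega> \<in> space M. (z, \<omega>) \<in> Bad} \<le> q" if zA: "z \<in> A" for z
    proof -
      have z: "z \<in> ZZ" using zA AZ by auto
      have md: "m \<le> mean_D z" by (rule d(1)[OF zA])
      have ev: "{\<omega> \<in> space M. (z, \<omega>) \<in> deviant n t F} \<in> events"
      proof -
        have "(\<lambda>\<omega>. (z, \<omega>)) \<in> M \<rightarrow>\<^sub>M restrict_space borel ZZ \<Otimes>\<^sub>M M"
          by (rule measurable_Pair1') (use z in \<open>simp add: space_restrict_space\<close>)
        from measurable_sets[OF this sets_deviant[OF F(1,2)]] show ?thesis
          by (simp add: vimage_def Int_def conj_commute)
      qed
      have "{\<omega> \<in> space M. (z, \<omega>) \<in> Bad} = {\<omega> \<in> space M. (z, \<omega>) \<in> deviant n t F} \<union> N"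
        using z sets.sets_into_space[of N M] N by (auto simp: Bad_def)
      then have "prob {\<omega> \<in> space M. (z, \<omega>) \<in> Bad} = prob {\<omega> \<in> space M. (z, \<omega>) \<in> deviant n t F}"
        using measure_Un_null_set[OF ev N] by simp
      also have "\<dots> \<le> (real (card F) + 1) * tail n t z"
        using md d(2) t by (intro prob_deviant_le z F n) auto
      also have "\<dots> \<le> q"
        unfolding q_def
      proof (rule mult_mono)
        have "real n * m / sup_bound \<le> real n * mean_D z / sup_bound"
          using md sup_bound_pos by (intro divide_right_mono mult_left_mono) auto
        then have "(t\<^sup>2 / (4 * lmax)) * (real n * m / sup_bound) \<le> (t\<^sup>2 / (4 * lmax)) * (real n * mean_D z / sup_bound)"
          using const_bounds by (intro mult_left_mono) auto
        then show "tail n t z \<le> 2 * exp (- (t\<^sup>2 / (4 * lmax)) * (real n * m / sup_bound))"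
          by (simp add: tail_def)
      qed (use card L_pos k in \<open>auto simp: tail_def\<close>)
      finally show ?thesis .
    qed
  qed
qed

end

section \<open>Effective sample size against the logarithm\<close>

text \<open>Polynomial growth loses against \<open>exp (- \<gamma> * N n)\<close> as soon as \<open>N\<close> outgrows the logarithm, for then
  the exponential is eventually below every power of \<open>1 / n\<close>.\<close>

lemma tail_times_net_tendsto_0:
  fixes N :: "nat \<Rightarrow> real"
  assumes lim: "(\<lambda>n. ln (real n) / N n) \<longlonglongrightarrow> 0" and N: "\<forall>\<^sub>F n in sequentially. 0 < N n"
    and K: "\<forall>\<^sub>F n in sequentially. 0 \<le> K n \<and> K n \<le> a * real n ^ p" and \<gamma>: "0 < \<gamma>"
  shows "(\<lambda>n. (K n + 1) * exp (- \<gamma> * N n)) \<longlonglongrightarrow> 0"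
proof (rule tendsto_sandwich)
  have small: "\<forall>\<^sub>F n in sequentially. ln (real n) / N n < \<gamma> / real (p + 1)"
    using \<gamma> by (intro order_tendstoD(2)[OF lim]) auto
  show "\<forall>\<^sub>F n in sequentially. 0 \<le> (K n + 1) * exp (- \<gamma> * N n)"
    using K by eventually_elim auto
  show "\<forall>\<^sub>F n in sequentially. (K n + 1) * exp (- \<gamma> * N n) \<le> (\<bar>a\<bar> + 1) * (1 / real n)"
    using small N K eventually_ge_at_top[of 1]
  proof eventually_elim
    case (elim n)
    then have n: "1 \<le> real n" by simp
    have "ln (real n) < \<gamma> / real (p + 1) * N n" using elim by (simp add: pos_divide_less_eq)
    then have "real (p + 1) * ln (real n) \<le> \<gamma> * N n"
      by (simp add: field_simps del: of_nat_add of_nat_Suc)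
    then have "exp (- \<gamma> * N n) \<le> exp (- (real (p + 1) * ln (real n)))" by simp
    also have "\<dots> = 1 / real n ^ (p + 1)"
      using n by (simp add: exp_minus exp_of_nat_mult inverse_eq_divide del: of_nat_add of_nat_Suc)
    finally have e: "exp (- \<gamma> * N n) \<le> 1 / real n ^ (p + 1)" .
    have "1 \<le> real n ^ p" using n by simp
    moreover have "a * real n ^ p \<le> \<bar>a\<bar> * real n ^ p" by (intro mult_right_mono) auto
    ultimately have "K n + 1 \<le> (\<bar>a\<bar> + 1) * real n ^ p" using elim(3) unfolding distrib_right by linarith
    then have "(K n + 1) * exp (- \<gamma> * N n) \<le> ((\<bar>a\<bar> + 1) * real n ^ p) * (1 / real n ^ (p + 1))"
      using e elim by (intro mult_mono) auto
    also have "\<dots> = (\<bar>a\<bar> + 1) * (1 / real n)" using n by simp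
    finally show ?case .
  qed
  show "(\<lambda>n. (\<bar>a\<bar> + 1) * (1 / real n)) \<longlonglongrightarrow> 0"
    using tendsto_mult_right_zero[OF lim_1_over_n] by auto
qed auto

text \<open>Once both bandwidths are below one, the argument of the logarithm in the rate is at least \<open>n\<close>. The
  linear term of the rate therefore dominates \<open>ln n / (n h\<^sub>Z\<^sup>d h\<^sub>U\<^sup>2)\<close>; its square root term is
  nonnegative.\<close>

lemma log_over_effective_size_tendsto_0:
  fixes hZ hU m \<delta> :: "nat \<Rightarrow> real"
  assumes rate: "(\<lambda>n. rate d C n (hZ n) (hU n) (\<delta> n) / m n) \<longlonglongrightarrow> 0"
    and C: "1 \<le> C" and \<delta>: "\<And>n. 0 < \<delta> n \<and> \<delta> n < 1" and m: "\<And>n. 1 \<le> n \<Longrightarrow> 0 < m n"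
    and h: "\<And>n. 1 \<le> n \<Longrightarrow> 0 < hZ n \<and> 0 < hU n" and lim: "hZ \<longlonglongrightarrow> 0" "hU \<longlonglongrightarrow> 0"
  shows "(\<lambda>n. ln (real n) / (real n * hZ n ^ d * (hU n)\<^sup>2 * m n)) \<longlonglongrightarrow> 0"
proof (rule tendsto_sandwich[OF _ _ tendsto_const rate])
  have small: "\<forall>\<^sub>F n in sequentially. hZ n < 1" "\<forall>\<^sub>F n in sequentially. hU n < 1"
    using lim by (auto intro: order_tendstoD)
  show "\<forall>\<^sub>F n in sequentially. 0 \<le> ln (real n) / (real n * hZ n ^ d * (hU n)\<^sup>2 * m n)"
    using eventually_ge_at_top[of 1]
  proof eventually_elim
    case (elim n)
    then show ?case using h[of n] m[of n] by (intro divide_nonneg_pos mult_pos_pos) auto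
  qed
  show "\<forall>\<^sub>F n in sequentially. ln (real n) / (real n * hZ n ^ d * (hU n)\<^sup>2 * m n)
      \<le> rate d C n (hZ n) (hU n) (\<delta> n) / m n"
    using small eventually_ge_at_top[of 1]
  proof eventually_elim
    case (elim n)
    define N where "N = real n * hZ n ^ d * (hU n)\<^sup>2"
    define x where "x = ln (C * real n / (\<delta> n * hZ n ^ d * (hU n)\<^sup>2)) / N"
    have hn: "0 < hZ n" "0 < hU n" "0 < m n" using h[of n] m[of n] elim by auto
    have N: "0 < N" using hn elim by (simp add: N_def)
    have pos: "0 < \<delta> n * hZ n ^ d * (hU n)\<^sup>2" using \<delta> hn by simp
    have "\<delta> n * hZ n ^ d * (hU n)\<^sup>2 \<le> 1 * 1 * 1"
      using \<delta>[of n] hn elim by (intro mult_mono power_le_one) auto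
    then have "real n * (\<delta> n * hZ n ^ d * (hU n)\<^sup>2) \<le> real n * C"
      using C by (intro mult_left_mono) auto
    then have "real n \<le> C * real n / (\<delta> n * hZ n ^ d * (hU n)\<^sup>2)"
      using pos by (simp add: pos_le_divide_eq mult.commute[of C])
    then have "ln (real n) \<le> ln (C * real n / (\<delta> n * hZ n ^ d * (hU n)\<^sup>2))"
      using elim by (intro ln_mono) auto
    then have lx: "ln (real n) / N \<le> x" unfolding x_def using N by (intro divide_right_mono) auto
    moreover have "0 \<le> ln (real n) / N" using N elim by simp
    ultimately have "0 \<le> x" by linarith
    then have "ln (real n) / N \<le> sqrt x + x" using lx real_sqrt_ge_zero[of x] by linarith
    also have "sqrt x + x = rate d C n (hZ n) (hU n) (\<delta> n)" by (simp add: rate_def x_def N_def)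
    finally have "ln (real n) / N / m n \<le> rate d C n (hZ n) (hU n) (\<delta> n) / m n"
      using hn by (intro divide_right_mono) auto
    then show ?case by (simp add: N_def)
  qed
qed

text \<open>Makes the cardinality of the net, a power of \<open>1 / h\<^sub>U\<close>, polynomial in \<open>n\<close>.\<close>

lemma inverse_bandwidth_le:
  fixes hZ hU :: "nat \<Rightarrow> real"
  assumes r: "filterlim (\<lambda>n. real n * hZ n ^ d * (hU n)\<^sup>2 / ln (real n)) at_top sequentially"
    and h: "\<And>n. 1 \<le> n \<Longrightarrow> 0 < hZ n \<and> 0 < hU n" and lim: "hZ \<longlonglongrightarrow> 0"
  shows "\<forall>\<^sub>F n in sequentially. 1 / (hU n)\<^sup>2 \<le> real n"
proof -
  have "\<forall>\<^sub>F n in sequentially. 1 \<le> real n * hZ n ^ d * (hU n)\<^sup>2 / ln (real n)"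
    using r by (simp add: filterlim_at_top)
  moreover have "\<forall>\<^sub>F n in sequentially. hZ n < 1" using lim by (auto intro: order_tendstoD)
  ultimately show ?thesis using eventually_ge_at_top[of 3]
  proof eventually_elim
    case (elim n)
    have hn: "0 < hZ n" "0 < hU n" using h[of n] elim by auto
    have "exp 1 \<le> real n" using exp_le elim by (intro order.trans[OF exp_le]) auto
    then have ln: "1 \<le> ln (real n)" using elim by (subst ln_ge_iff) auto
    then have "ln (real n) \<le> real n * hZ n ^ d * (hU n)\<^sup>2" using elim by (simp add: pos_le_divide_eq)
    moreover have "real n * hZ n ^ d * (hU n)\<^sup>2 \<le> real n * 1 * (hU n)\<^sup>2"
      using hn elim by (intro mult_right_mono mult_left_mono power_le_one) auto
    ultimately have "1 \<le> real n * (hU n)\<^sup>2" using ln by simp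
    then show ?case using hn by (simp add: pos_divide_le_eq)
  qed
qed

section \<open>Consistency in probability\<close>

theorem proposition3:
  fixes M :: "'a measure"
    and L C CZ Mw B :: real
    and ZZ :: "(real ^ 'd) set"
    and Z :: "'a \<Rightarrow> real ^ 'd" and D :: "'a \<Rightarrow> diagram"
    and Zs :: "nat \<Rightarrow> 'a \<Rightarrow> real ^ 'd" and Ds :: "nat \<Rightarrow> 'a \<Rightarrow> diagram"
    and w :: "real \<times> real \<Rightarrow> real"
    and KZ :: "real ^ 'd \<Rightarrow> real" and KU :: "real \<times> real \<Rightarrow> real"
    and hZ hU \<rho> :: "nat \<Rightarrow> real"
    and \<Lambda> :: "real ^ 'd \<Rightarrow> (real \<times> real) measure"
    and lam :: "real ^ 'd \<Rightarrow> real \<times> real \<Rightarrow> real"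
    and pZ :: "real ^ 'd \<Rightarrow> real"
  defines "S \<equiv> restrict_space borel ZZ \<Otimes>\<^sub>M diagram_space L"
    and "PZ \<equiv> distr M (restrict_space borel ZZ) Z"
    and "D_h \<equiv> \<lambda>n z. \<integral>\<omega>. D_hat ZZ KZ (hZ n) n (\<lambda>i. Zs i \<omega>) z \<partial>M"
  assumes L_pos: "0 < L" and C_ge_1: "1 \<le> C"
    and M_prob: "prob_space M"
    and ZD_rv: "(\<lambda>\<omega>. (Z \<omega>, D \<omega>)) \<in> M \<rightarrow>\<^sub>M S"
    and indep: "prob_space.indep_vars M (\<lambda>_. S) (\<lambda>i \<omega>. (Zs i \<omega>, Ds i \<omega>)) UNIV"
    and ident: "\<And>i. distr M S (\<lambda>\<omega>. (Zs i \<omega>, Ds i \<omega>)) = distr M S (\<lambda>\<omega>. (Z \<omega>, D \<omega>))"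
    and w_weight: "weight L w"
    and w_bounded: "bounded (w ` Omega_closed L)"
    and w_lipschitz: "\<exists>c. c-lipschitz_on (Omega_closed L) w"
    and KZ: "smoothing_kernel KZ" and KU: "smoothing_kernel KU"
    and h_pos: "\<And>n. 1 \<le> n \<Longrightarrow> 0 < hZ n \<and> 0 < hU n"
    and hZ_lim: "hZ \<longlonglongrightarrow> 0" and hU_lim: "hU \<longlonglongrightarrow> 0"
    and h_rate: "filterlim (\<lambda>n. real n * hZ n ^ CARD('d) * (hU n)\<^sup>2 / ln (real n)) at_top sequentially"
    and ZZ_compact: "compact ZZ"
    and ZZ_cone: "\<exists>r>0. \<exists>\<eta>>0. \<forall>z\<in>ZZ. \<exists>\<xi>. norm \<xi> = 1 \<and>
        {z + t *\<^sub>R v | t v. 0 < t \<and> t < r \<and> norm v = 1 \<and> norm (v - \<xi>) < \<eta>} \<subseteq> ZZ"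
    and \<Lambda>: "\<And>i. conditional_intensity M ZZ L w (Zs i) (Ds i) \<Lambda>"
    and \<Lambda>_density: "\<And>z. z \<in> ZZ \<Longrightarrow>
        \<Lambda> z = density (restrict_space lborel (Omega_closed L)) (\<lambda>u. ennreal (lam z u))"
    and lam_nonneg: "\<And>z u. z \<in> ZZ \<Longrightarrow> u \<in> Omega_closed L \<Longrightarrow> 0 \<le> lam z u"
    and lam_bounded: "bounded ((\<lambda>(z, u). lam z u) ` (ZZ \<times> Omega_closed L))"
    and lam_ucont: "uniformly_continuous_on (ZZ \<times> Omega_closed L) (\<lambda>(z, u). lam z u)"
    and mass_bound: "\<And>i. AE \<omega> in M.
        emeasure (weighted_diagram_measure L w (Ds i \<omega>)) (Omega_closed L) \<le> ennreal Mw"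
    and pZ_nonneg: "\<And>z. z \<in> ZZ \<Longrightarrow> 0 \<le> pZ z"
    and pZ_density: "distributed M (restrict_space lborel ZZ) Z (\<lambda>z. ennreal (pZ z))"
    and pZ_bound: "\<And>z. z \<in> ZZ \<Longrightarrow> pZ z \<le> CZ"
    and \<rho>_pos: "\<And>n. 1 \<le> n \<Longrightarrow> 0 < \<rho> n" and \<rho>_decseq: "decseq \<rho>" and \<rho>_lim: "\<rho> \<longlonglongrightarrow> 0"
    and region: "\<And>\<epsilon>::real. 0 < \<epsilon> \<Longrightarrow> \<exists>A m \<delta>.
        A \<in> sets borel \<and> A \<subseteq> ZZ \<and>
        (\<forall>n\<ge>1. 0 < m n) \<and>
        (\<forall>n. 0 < \<delta> n \<and> \<delta> n < 1) \<and> decseq \<delta> \<and> \<delta> \<longlonglongrightarrow> 0 \<and>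
        measure PZ A > 1 - \<epsilon> \<and>
        (\<forall>n\<ge>1. \<forall>z\<in>A. m n \<le> D_h n z) \<and>
        (\<lambda>n. rate CARD('d) C n (hZ n) (hU n) (\<delta> n) / m n) \<longlonglongrightarrow> 0 \<and>
        (\<forall>\<^sub>F n in sequentially. \<rho> n \<le> m n / 2)"
    and B: "(SUP (z, u) \<in> ZZ \<times> Omega_closed L. \<bar>lam z u\<bar>) < B"
  shows "tendsto_zero_in_probability M (\<lambda>n \<omega>.
           integrated_uniform_loss PZ L
             (lambda_hat ZZ L w KZ KU (hZ n) (hU n) (\<rho> n) B n (\<lambda>i. Zs i \<omega>) (\<lambda>i. Ds i \<omega>)) lam)"
proof -
  interpret prob_space M by (rule M_prob)
  have Zm: "Z \<in> M \<rightarrow>\<^sub>M restrict_space borel ZZ"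
    using measurable_compose[OF ZD_rv[unfolded S_def] measurable_fst] by simp
  have PZ_prob: "prob_space PZ" unfolding PZ_def by (rule prob_space_distr[OF Zm])
  have PZ_sets: "sets PZ = sets (restrict_space borel ZZ)" by (simp add: PZ_def)
  obtain \<omega>0 where "\<omega>0 \<in> space M" using not_empty by blast
  then have Z0: "Z \<omega>0 \<in> ZZ" using measurable_space[OF Zm] by (simp add: space_restrict_space)
  have U0: "(0, 0) \<in> Omega_closed L" using L_pos by (simp add: Omega_closed_def)
  have "bdd_above ((\<lambda>(z, u). \<bar>lam z u\<bar>) ` (ZZ \<times> Omega_closed L))"
    using lam_bounded unfolding bounded_iff bdd_above_def by (force simp: case_prod_beta')
  then have absB: "\<bar>lam z u\<bar> < B" if "z \<in> ZZ" "u \<in> Omega_closed L" for z u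
    using cSUP_upper[of "(z, u)" "ZZ \<times> Omega_closed L" "\<lambda>(z, u). \<bar>lam z u\<bar>"] that B by auto
  then have lamB: "lam z u \<le> B" if "z \<in> ZZ" "u \<in> Omega_closed L" for z u
    using that by (meson abs_le_D1 less_imp_le)
  have B0: "0 < B" using absB[OF Z0 U0] by linarith
  define lmax where "lmax = max 1 B"
  define Mw' where "Mw' = max 1 Mw"
  obtain r \<eta> where cone: "0 < r" "0 < \<eta>" "\<forall>z\<in>ZZ. \<exists>\<xi>. norm \<xi> = 1 \<and>
        {z + t *\<^sub>R v | t v. 0 < t \<and> t < r \<and> norm v = 1 \<and> norm (v - \<xi>) < \<eta>} \<subseteq> ZZ"
    using ZZ_cone by (elim exE conjE)
  have ZZ_balls: "uniform_interior_balls ZZ"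
    by (rule uniform_interior_balls_cone[OF cone(1,2)]) (rule bspec[OF cone(3)])
  have U_balls: "uniform_interior_balls (Omega_closed L)"
    using L_pos by (intro uniform_interior_balls_convex Omega_closed_convex Omega_closed_interior
        compact_imp_bounded Omega_closed_compact)
  obtain QZ h1 where QZ: "0 < QZ" "0 < h1"
    "\<And>h x. 0 < h \<Longrightarrow> h < h1 \<Longrightarrow> x \<in> ZZ \<Longrightarrow> 0 < kernel_mass ZZ KZ h x"
    "\<And>h x y. 0 < h \<Longrightarrow> h < h1 \<Longrightarrow> x \<in> ZZ \<Longrightarrow> normalized_kernel ZZ KZ h x y \<le> QZ / h ^ DIM(real ^ 'd)"
    by (rule normalized_kernel_uniform_bounds[OF KZ ZZ_compact ZZ_balls]) (rule that)
  obtain Q h2 where Q: "0 < Q" "0 < h2" "h2 \<le> 1"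
    "\<And>h x. 0 < h \<Longrightarrow> h < h2 \<Longrightarrow> x \<in> Omega_closed L \<Longrightarrow> 0 < kernel_mass (Omega_closed L) KU h x"
    "\<And>h x y. 0 < h \<Longrightarrow> h < h2 \<Longrightarrow> x \<in> Omega_closed L \<Longrightarrow>
       normalized_kernel (Omega_closed L) KU h x y \<le> Q / h ^ DIM(real \<times> real)"
    "\<And>h x x' y. 0 < h \<Longrightarrow> h < h2 \<Longrightarrow> x \<in> Omega_closed L \<Longrightarrow> x' \<in> Omega_closed L \<Longrightarrow>
       \<bar>normalized_kernel (Omega_closed L) KU h x y - normalized_kernel (Omega_closed L) KU h x' y\<bar>
         \<le> Q / h ^ (2 * DIM(real \<times> real) + 1) * dist x x'"
    by (rule normalized_kernel_uniform_bounds[OF KU Omega_closed_compact U_balls]) (rule that)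
  define QU where "QU = max 1 Q"
  have sample: "smoothed_sample M L ZZ Zs Ds w KZ KU \<Lambda> lam (hZ n) (hU n) QZ QU Mw' lmax"
    if n: "1 \<le> n" and small: "hZ n < h1" "hU n < h2" for n
  proof (intro smoothed_sample.intro M_prob smoothed_sample_axioms.intro)
    have hn: "0 < hZ n" "0 < hU n" using h_pos[OF n] by auto
    show "0 < hZ n" "0 < hU n" "hU n \<le> 1" using hn small Q by auto
    show "distr M (restrict_space borel ZZ \<Otimes>\<^sub>M diagram_space L) (\<lambda>\<omega>. (Zs i \<omega>, Ds i \<omega>))
        = distr M (restrict_space borel ZZ \<Otimes>\<^sub>M diagram_space L) (\<lambda>\<omega>. (Zs 0 \<omega>, Ds 0 \<omega>))" for i
      using ident[of i] ident[of 0] by (simp add: S_def)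
    show "normalized_kernel (Omega_closed L) KU (hU n) u v \<le> QU / (hU n)\<^sup>2" if "u \<in> Omega_closed L" for u v
    proof -
      have "Q / (hU n)\<^sup>2 \<le> QU / (hU n)\<^sup>2" by (intro divide_right_mono) (auto simp: QU_def)
      then show ?thesis using Q(5)[OF hn(2) small(2) that, of v] by (simp add: power2_eq_square)
    qed
    show "\<bar>normalized_kernel (Omega_closed L) KU (hU n) u v - normalized_kernel (Omega_closed L) KU (hU n) u' v\<bar>
        \<le> QU / hU n ^ 5 * dist u u'" if "u \<in> Omega_closed L" "u' \<in> Omega_closed L" for u u' v
    proof -
      have "Q / hU n ^ 5 * dist u u' \<le> QU / hU n ^ 5 * dist u u'"
        using hn by (intro mult_right_mono divide_right_mono) (auto simp: QU_def)
      then show ?thesis using Q(6)[OF hn(2) small(2) that, of v] by simp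
    qed
    show "AE \<omega> in M. emeasure (weighted_diagram_measure L w (Ds i \<omega>)) (Omega_closed L) \<le> ennreal Mw'" for i
      using mass_bound[of i] by eventually_elim (auto simp: Mw'_def intro: order.trans ennreal_leI)
    show "continuous_on (Omega_closed L) (lam z)" if "z \<in> ZZ" for z
    proof -
      have "continuous_on (Omega_closed L) (\<lambda>u. (z, u))" by (intro continuous_intros)
      moreover have "(\<lambda>u. (z, u)) ` Omega_closed L \<subseteq> ZZ \<times> Omega_closed L" using that by auto
      ultimately show ?thesis
        using continuous_on_compose2[OF uniformly_continuous_imp_continuous[OF lam_ucont]] by fastforce
    qed
    show "lam z u \<le> lmax" if "z \<in> ZZ" "u \<in> Omega_closed L" for z u
      using lamB[OF that] by (simp add: lmax_def)
  qed (use L_pos ZZ_compact indep S_def w_weight KZ KU QZ Q \<Lambda> \<Lambda>_density lam_nonneg small h_pos[OF n] in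
      \<open>auto simp: QU_def Mw'_def lmax_def\<close>)
  show ?thesis
    unfolding tendsto_zero_in_probability_def
  proof (intro allI impI)
    fix e :: real assume e: "0 < e"
    define \<epsilon> where "\<epsilon> = e / (4 * B)"
    have \<epsilon>: "0 < \<epsilon>" "B * \<epsilon> = e / 4" using e B0 by (auto simp: \<epsilon>_def)
    obtain A m \<delta> where A: "A \<in> sets borel" "A \<subseteq> ZZ" and m: "\<forall>n\<ge>1. 0 < m n"
      and \<delta>: "\<forall>n. 0 < \<delta> n \<and> \<delta> n < 1" and PA: "measure PZ A > 1 - \<epsilon>"
      and mD: "\<forall>n\<ge>1. \<forall>z\<in>A. m n \<le> D_h n z"
      and rate: "(\<lambda>n. rate CARD('d) C n (hZ n) (hU n) (\<delta> n) / m n) \<longlonglongrightarrow> 0"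
      and \<rho>m: "\<forall>\<^sub>F n in sequentially. \<rho> n \<le> m n / 2"
      using region[OF \<epsilon>(1)] by (elim exE conjE)
    have m: "0 < m n" if "1 \<le> n" for n using m that by blast
    have A_sets: "A \<in> sets PZ"
      unfolding PZ_sets sets_restrict_space using A by blast
    (* the same t serves as relative deviation and as oscillation of lam;
       the covariates outside A contribute at most B * \<epsilon> = e / 4 to the loss *)
    define t where "t = min (1/2) (e / (8 * (4 + B)))"
    have t: "0 < t" "t \<le> 1/2" using e B0 unfolding t_def by (simp, linarith)
    have "2 * (2 * t + t * B + 2 * t) = 2 * (4 + B) * t" by (simp add: algebra_simps)
    also have "\<dots> \<le> 2 * (4 + B) * (e / (8 * (4 + B)))"
      using B0 by (intro mult_left_mono) (auto simp: t_def)
    also have "\<dots> = e / 4" using B0 by (simp add: field_simps)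
    finally have te: "2 * (2 * t + t * B + 2 * t) + B * \<epsilon> \<le> e / 2" using \<epsilon> by simp
    obtain \<Delta> where \<Delta>: "0 < \<Delta>" and unif: "\<forall>p\<in>ZZ \<times> Omega_closed L. \<forall>p'\<in>ZZ \<times> Omega_closed L.
        dist p' p < \<Delta> \<longrightarrow> dist (case p' of (z, u) \<Rightarrow> lam z u) (case p of (z, u) \<Rightarrow> lam z u) < t"
      using lam_ucont t(1) unfolding uniformly_continuous_on_def by blast
    define c where "c = 4 * L * QU * Mw' / t + 1"
    define \<gamma> where "\<gamma> = t\<^sup>2 / (4 * lmax) / (QZ * QU * Mw')"
    have \<gamma>: "0 < \<gamma>" unfolding \<gamma>_def using t QZ
      by (intro divide_pos_pos mult_pos_pos) (auto simp: lmax_def QU_def Mw'_def)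
    define N where "N n = real n * hZ n ^ CARD('d) * (hU n)\<^sup>2 * m n" for n
    define q where "q n = (c\<^sup>2 / hU n ^ 10 + 1) * exp (- \<gamma> * N n)" for n
    have "q \<longlonglongrightarrow> 0"
      unfolding q_def[abs_def]
    proof (rule tail_times_net_tendsto_0[where a="c\<^sup>2" and p=5, OF _ _ _ \<gamma>])
      show "(\<lambda>n. ln (real n) / N n) \<longlonglongrightarrow> 0"
        unfolding N_def by (rule log_over_effective_size_tendsto_0[OF rate C_ge_1 spec[OF \<delta>] m h_pos hZ_lim hU_lim])
      show "\<forall>\<^sub>F n in sequentially. 0 < N n"
        using eventually_ge_at_top[of 1]
      proof eventually_elim
        case (elim n)
        then show ?case using h_pos[of n] m[of n] by (auto simp: N_def intro!: mult_pos_pos)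
      qed
      have inv: "\<forall>\<^sub>F n in sequentially. 1 / (hU n)\<^sup>2 \<le> real n"
        by (rule inverse_bandwidth_le[OF h_rate h_pos hZ_lim])
      show "\<forall>\<^sub>F n in sequentially. 0 \<le> c\<^sup>2 / hU n ^ 10 \<and> c\<^sup>2 / hU n ^ 10 \<le> c\<^sup>2 * real n ^ 5"
        using inv eventually_ge_at_top[of 1]
      proof eventually_elim
        case (elim n)
        have "(1 / (hU n)\<^sup>2) ^ 5 \<le> real n ^ 5" using elim by (intro power_mono) auto
        then have "c\<^sup>2 * (1 / (hU n)\<^sup>2) ^ 5 \<le> c\<^sup>2 * real n ^ 5" by (intro mult_left_mono) auto
        then show ?case using h_pos[of n] elim by (simp add: power_divide power_mult[symmetric])
      qed
    qed
    then have "(\<lambda>n. ennreal (4 * B / e * q n)) \<longlonglongrightarrow> ennreal 0"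
      by (intro tendsto_ennrealI tendsto_mult_right_zero)
    then have lim: "(\<lambda>n. ennreal (4 * B / e * q n)) \<longlonglongrightarrow> 0" by simp
    have ev: "\<forall>\<^sub>F n in sequentially. hZ n < min h1 (\<Delta> / 2)" "\<forall>\<^sub>F n in sequentially. hU n < min h2 (\<Delta> / 2)"
      using order_tendstoD(2)[OF hZ_lim, of "min h1 (\<Delta> / 2)"] order_tendstoD(2)[OF hU_lim, of "min h2 (\<Delta> / 2)"]
        QZ(2) Q(2) \<Delta> by simp_all
    let ?loss = "\<lambda>n \<omega>. integrated_uniform_loss PZ L
             (lambda_hat ZZ L w KZ KU (hZ n) (hU n) (\<rho> n) B n (\<lambda>i. Zs i \<omega>) (\<lambda>i. Ds i \<omega>)) lam"
    have "\<forall>\<^sub>F n in sequentially. outer_measure_of M {\<omega> \<in> space M. ennreal e < ?loss n \<omega>} \<le> ennreal (4 * B / e * q n)"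
      using ev \<rho>m eventually_ge_at_top[of 1]
    proof eventually_elim
      case (elim n)
      interpret smoothed_sample M L ZZ Zs Ds w KZ KU \<Lambda> lam "hZ n" "hU n" QZ QU Mw' lmax
        by (rule sample) (use elim in auto)
      have "outer_measure_of M {\<omega> \<in> space M. ennreal e < ?loss n \<omega>}
        \<le> ennreal (2 * B * (((4 * L * QU * Mw' / t + 1)\<^sup>2 / hU n ^ 10 + 1) *
           (2 * exp (- (t\<^sup>2 / (4 * lmax)) * (real n * m n / sup_bound)))) / e)"
      proof (rule loss_exceeds_le[OF PZ_prob PZ_sets A_sets PA])
        show "m n \<le> mean_D z" if "z \<in> A" for z
        proof -
          have "z \<in> ZZ" "0 < n" using that A(2) elim(4) by auto
          then have "D_h n z = mean_D z" unfolding D_h_def by (rule expectation_hat_D)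
          then show ?thesis using mD elim(4) that by metis
        qed
        show "0 < m n" "0 < \<rho> n" "\<rho> n \<le> m n / 2" "0 < n" using m \<rho>_pos elim by auto
        show "0 \<le> B" "0 < e" "0 < t" "t \<le> 1/2" "0 \<le> t" using B0 e t by auto
        show "2 * (2 * t + t * B + 2 * t) + B * \<epsilon> \<le> e / 2" by (rule te)
        show "lam z u \<le> B" if "z \<in> ZZ" "u \<in> Omega_closed L" for z u by (rule lamB[OF that])
        show "\<bar>lam z' y - lam z x\<bar> \<le> t"
          if "z \<in> ZZ" "x \<in> Omega_closed L" "z' \<in> ZZ" "y \<in> Omega_closed L" "dist z z' \<le> hZ n" "dist x y \<le> hU n"
          for z x z' y
        proof -
          have "dist (z', y) (z, x) \<le> dist z' z + dist y x"
            unfolding dist_Pair_Pair by (rule sqrt_sum_squares_le_sum) auto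
          then have "dist (z', y) (z, x) < \<Delta>" using that elim by (simp add: dist_commute)
          then have "dist (lam z' y) (lam z x) < t"
            using bspec[OF bspec[OF unif, of "(z, x)"], of "(z', y)"] that by simp
          then show ?thesis by (simp add: dist_real_def)
        qed
      qed
      also have "- (t\<^sup>2 / (4 * lmax)) * (real n * m n / sup_bound) = - \<gamma> * N n"
        by (simp add: \<gamma>_def N_def sup_bound_def)
      also have "2 * B * (((4 * L * QU * Mw' / t + 1)\<^sup>2 / hU n ^ 10 + 1) * (2 * exp (- \<gamma> * N n))) / e
          = 4 * B / e * q n"
        unfolding q_def c_def by (simp only: times_divide_eq_left times_divide_eq_right mult_ac)
      finally show ?case .
    qed
    then show "(\<lambda>n. outer_measure_of M {\<omega> \<in> space M. ennreal e < ?loss n \<omega>}) \<longlonglongrightarrow> 0"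
      by (intro tendsto_sandwich[OF _ _ tendsto_const lim]) auto
  qed
qed

end
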